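(* For a computable finitely generated group $G$, the following are equivalent: (1) $G$ has a computable $\Pi_3$ Scott sentence; (2) $G$ has a computable $d$-$\Sigma_2$ Scott sentence; (3) for some generating tuple of $G$, the orbit (under the automorphism group of $G$) is defined in $G$ by a computable $\Pi_1$ formula; (4) for each generating tuple of $G$, the orbit is defined in $G$ by a computable $\Pi_1$ formula.
   Context: Groups are structures in the language of groups (multiplication, inverse, identity), countably infinite with universe $\omega$; a group is computable if its atomic diagram (equivalently its multiplication table) is computable. A generating tuple of $G$ is a finite tuple of elements generating $G$. Defining formulas have no parameters. Computable infinitary formulas (with finitely many free variables) at finite levels: a formula is computable $\Sigma_0$ and computable $\Pi_0$ if it is finitary quantifier-free. For $n>0$, a computable $\Sigma_n$ formula $\varphi(\bar x)$ is the disjunction of a c.e. set (of indices) of formulas $(\exists\bar u)\psi(\bar x,\bar u)$ with each $\psi$ computable $\Pi_m$ for some $m<n$; a computable $\Pi_n$ formula $\varphi(\bar x)$ is the conjunction of a c.e. set (of indices) of formulas $(\forall\bar u)\psi(\bar x,\bar u)$ with each $\psi$ computable $\Sigma_m$ for some $m<n$. A formula is computable $d$-$\Sigma_n$ if it is the conjunction of a computable $\Sigma_n$ formula and a computable $\Pi_n$ formula. A Scott sentence for $G$ is a sentence of $L_{\omega_1\omega}$ whose countable models are exactly the isomorphic copies of $G$. *)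

theory Defs
  imports
    "HOL-Library.Nat_Bijection"
    "HOL-Algebra.Bij"
    "HOL-Algebra.Generated_Groups"
begin

section \<open>Partial computable functions, c.e. and computable sets\<close>

text \<open>
  Unary partial recursive functions on the naturals, with pairs coded by the Cantor pairing
  \<^const>\<open>prod_encode\<close>. The identity is \<open>PPair PFst PSnd\<close> and functions of several arguments take
  a coded tuple, so this is the usual class of (Kleene) partial recursive functions.
\<close>

datatype prog =
    PZero | PSuc | PFst | PSnd
  | PPair prog prog
  | PComp prog prog
  | PRec prog prog
  | PMin prog

text \<open>\<open>runs p x y\<close>: the program \<open>p\<close> halts on input \<open>x\<close> with output \<open>y\<close>.\<close>

inductive runs :: "prog \<Rightarrow> nat \<Rightarrow> nat \<Rightarrow> bool" where
  zero: "runs PZero x 0"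
| suc: "runs PSuc x (Suc x)"
| first: "runs PFst (prod_encode (x, y)) x"
| second: "runs PSnd (prod_encode (x, y)) y"
| pair: "runs p x y \<Longrightarrow> runs q x z \<Longrightarrow> runs (PPair p q) x (prod_encode (y, z))"
| comp: "runs q x y \<Longrightarrow> runs p y z \<Longrightarrow> runs (PComp p q) x z"
| rec_zero: "runs p x y \<Longrightarrow> runs (PRec p q) (prod_encode (x, 0)) y"
| rec_suc: "runs (PRec p q) (prod_encode (x, n)) y \<Longrightarrow>
    runs q (prod_encode (x, prod_encode (n, y))) z \<Longrightarrow>
    runs (PRec p q) (prod_encode (x, Suc n)) z"
| min: "runs p (prod_encode (x, n)) 0 \<Longrightarrow>
    (\<And>i. i < n \<Longrightarrow> \<exists>y. runs p (prod_encode (x, i)) (Suc y)) \<Longrightarrow>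
    runs (PMin p) x n"

primrec prog_code :: "prog \<Rightarrow> nat" where
  "prog_code PZero = prod_encode (0, 0)"
| "prog_code PSuc = prod_encode (1, 0)"
| "prog_code PFst = prod_encode (2, 0)"
| "prog_code PSnd = prod_encode (3, 0)"
| "prog_code (PPair p q) = prod_encode (4, prod_encode (prog_code p, prog_code q))"
| "prog_code (PComp p q) = prod_encode (5, prod_encode (prog_code p, prog_code q))"
| "prog_code (PRec p q) = prod_encode (6, prod_encode (prog_code p, prog_code q))"
| "prog_code (PMin p) = prod_encode (7, prog_code p)"

text \<open>The standard enumeration of the c.e. sets; numbers that are no program code give \<open>{}\<close>.\<close>

definition W :: "nat \<Rightarrow> nat set" where
  "W e = {x. \<exists>p y. prog_code p = e \<and> runs p x y}"

definition computable_set :: "nat set \<Rightarrow> bool" where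
  "computable_set A \<longleftrightarrow> (\<exists>p. \<forall>x. runs p x (if x \<in> A then 1 else 0))"

section \<open>Structures in the language of groups\<close>

text \<open>
  Structures for the language with symbols for multiplication, inverse and identity. They need
  not be groups, so the inverse is a separate operation and not \<^const>\<open>m_inv\<close>.
\<close>

record 'a gp_struct = "'a monoid" +
  invop :: "'a \<Rightarrow> 'a"

definition is_structure :: "'a gp_struct \<Rightarrow> bool" where
  "is_structure M \<longleftrightarrow>
     one M \<in> carrier M \<and>
     (\<forall>x\<in>carrier M. invop M x \<in> carrier M) \<and>
     (\<forall>x\<in>carrier M. \<forall>y\<in>carrier M. mult M x y \<in> carrier M)"

definition struct_iso :: "'a gp_struct \<Rightarrow> 'b gp_struct \<Rightarrow> bool" where
  "struct_iso M N \<longleftrightarrow>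
     (\<exists>h\<in>iso M N. h (one M) = one N \<and> (\<forall>x\<in>carrier M. h (invop M x) = invop N (h x)))"

definition struct_of_group :: "'a monoid \<Rightarrow> 'a gp_struct" where
  "struct_of_group G =
     \<lparr>carrier = carrier G, mult = mult G, one = one G, invop = m_inv G\<rparr>"

section \<open>Infinitary formulas\<close>

datatype tm = Var nat | One | Inv tm | Mul tm tm

datatype qf = Eq tm tm | QNot qf | QAnd qf qf | QOr qf qf

text \<open>
  Formulas of \<open>L\<^sub>\<omega>\<^sub>1\<^sub>\<omega>\<close>, built up from the finitary quantifier-free ones. \<open>Conj I f\<close> and
  \<open>Disj I f\<close> are the conjunction and disjunction of the countable family \<open>f i\<close>, \<open>i \<in> I\<close>; the
  values of \<open>f\<close> outside \<open>I\<close> are irrelevant.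
\<close>

datatype fm =
    QF qf
  | Neg fm
  | Conj "nat set" "nat \<Rightarrow> fm"
  | Disj "nat set" "nat \<Rightarrow> fm"
  | Ex nat fm
  | All nat fm

primrec tm_vars :: "tm \<Rightarrow> nat set" where
  "tm_vars (Var i) = {i}"
| "tm_vars One = {}"
| "tm_vars (Inv t) = tm_vars t"
| "tm_vars (Mul s t) = tm_vars s \<union> tm_vars t"

primrec qf_vars :: "qf \<Rightarrow> nat set" where
  "qf_vars (Eq s t) = tm_vars s \<union> tm_vars t"
| "qf_vars (QNot a) = qf_vars a"
| "qf_vars (QAnd a b) = qf_vars a \<union> qf_vars b"
| "qf_vars (QOr a b) = qf_vars a \<union> qf_vars b"

primrec free_vars :: "fm \<Rightarrow> nat set" where
  "free_vars (QF a) = qf_vars a"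
| "free_vars (Neg \<phi>) = free_vars \<phi>"
| "free_vars (Conj I f) = (\<Union>i\<in>I. free_vars (f i))"
| "free_vars (Disj I f) = (\<Union>i\<in>I. free_vars (f i))"
| "free_vars (Ex i \<phi>) = free_vars \<phi> - {i}"
| "free_vars (All i \<phi>) = free_vars \<phi> - {i}"

primrec tm_val :: "'a gp_struct \<Rightarrow> (nat \<Rightarrow> 'a) \<Rightarrow> tm \<Rightarrow> 'a" where
  "tm_val M s (Var i) = s i"
| "tm_val M s One = one M"
| "tm_val M s (Inv t) = invop M (tm_val M s t)"
| "tm_val M s (Mul t u) = mult M (tm_val M s t) (tm_val M s u)"

primrec qf_sat :: "'a gp_struct \<Rightarrow> (nat \<Rightarrow> 'a) \<Rightarrow> qf \<Rightarrow> bool" where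
  "qf_sat M s (Eq t u) \<longleftrightarrow> tm_val M s t = tm_val M s u"
| "qf_sat M s (QNot a) \<longleftrightarrow> \<not> qf_sat M s a"
| "qf_sat M s (QAnd a b) \<longleftrightarrow> qf_sat M s a \<and> qf_sat M s b"
| "qf_sat M s (QOr a b) \<longleftrightarrow> qf_sat M s a \<or> qf_sat M s b"

primrec sat :: "'a gp_struct \<Rightarrow> fm \<Rightarrow> (nat \<Rightarrow> 'a) \<Rightarrow> bool" where
  "sat M (QF a) = (\<lambda>s. qf_sat M s a)"
| "sat M (Neg \<phi>) = (\<lambda>s. \<not> sat M \<phi> s)"
| "sat M (Conj I f) = (\<lambda>s. \<forall>i\<in>I. sat M (f i) s)"
| "sat M (Disj I f) = (\<lambda>s. \<exists>i\<in>I. sat M (f i) s)"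
| "sat M (Ex i \<phi>) = (\<lambda>s. \<exists>x\<in>carrier M. sat M \<phi> (s(i := x)))"
| "sat M (All i \<phi>) = (\<lambda>s. \<forall>x\<in>carrier M. sat M \<phi> (s(i := x)))"

definition And :: "fm \<Rightarrow> fm \<Rightarrow> fm" where
  "And \<phi> \<psi> = Conj {0, 1} (\<lambda>i. if i = 0 then \<phi> else \<psi>)"

text \<open>
  The tuple of variables of a formula with \<open>k\<close> free variables is \<open>Var 0, \<dots>, Var (k - 1)\<close>; a
  block of \<open>l\<close> quantifiers in front of a formula with \<open>k + l\<close> free variables binds
  \<open>Var k, \<dots>, Var (k + l - 1)\<close>.
\<close>

definition Ex_block :: "nat \<Rightarrow> nat \<Rightarrow> fm \<Rightarrow> fm" where
  "Ex_block k l \<phi> = foldr Ex [k..<k + l] \<phi>"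

definition All_block :: "nat \<Rightarrow> nat \<Rightarrow> fm \<Rightarrow> fm" where
  "All_block k l \<phi> = foldr All [k..<k + l] \<phi>"

definition sentence :: "fm \<Rightarrow> bool" where
  "sentence \<phi> \<longleftrightarrow> free_vars \<phi> = {}"

definition models :: "'a gp_struct \<Rightarrow> fm \<Rightarrow> bool" where
  "models M \<phi> \<longleftrightarrow> (\<forall>s. range s \<subseteq> carrier M \<longrightarrow> sat M \<phi> s)"

text \<open>
  The \<open>k\<close>-ary relation defined in \<open>M\<close> by a formula with free variables among
  \<open>Var 0, \<dots>, Var (k - 1)\<close>.
\<close>

definition defined_rel :: "'a gp_struct \<Rightarrow> nat \<Rightarrow> fm \<Rightarrow> 'a list set" where
  "defined_rel M k \<phi> = {xs. length xs = k \<and> set xs \<subseteq> carrier M \<and> sat M \<phi> (\<lambda>i. xs ! i)}"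

section \<open>Computable infinitary formulas\<close>

primrec tm_code :: "tm \<Rightarrow> nat" where
  "tm_code (Var i) = prod_encode (0, i)"
| "tm_code One = prod_encode (1, 0)"
| "tm_code (Inv t) = prod_encode (2, tm_code t)"
| "tm_code (Mul s t) = prod_encode (3, prod_encode (tm_code s, tm_code t))"

primrec qf_code :: "qf \<Rightarrow> nat" where
  "qf_code (Eq s t) = prod_encode (0, prod_encode (tm_code s, tm_code t))"
| "qf_code (QNot a) = prod_encode (1, qf_code a)"
| "qf_code (QAnd a b) = prod_encode (2, prod_encode (qf_code a, qf_code b))"
| "qf_code (QOr a b) = prod_encode (3, prod_encode (qf_code a, qf_code b))"

text \<open>
  \<open>Sigma_index n k e \<phi>\<close>: \<open>\<phi>\<close> is a computable \<open>\<Sigma>\<^sub>n\<close> formula with \<open>k\<close> free variables and index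
  \<open>e\<close>; likewise \<open>Pi_index\<close>. For \<open>n = 0\<close> an index is a code of a quantifier-free formula. For
  \<open>n > 0\<close> it is an index of a c.e. set of triples \<open>(l, m, j)\<close> with \<open>m < n\<close>, each standing for the
  formula \<open>\<exists>u \<psi>\<close> (resp. \<open>\<forall>u \<psi>\<close>) where \<open>u\<close> has length \<open>l\<close> and \<open>\<psi>\<close> is the \<open>\<Pi>\<^sub>m\<close>
  (resp. \<open>\<Sigma>\<^sub>m\<close>) formula with \<open>k + l\<close> free variables and index \<open>j\<close>.
\<close>

inductive Sigma_index :: "nat \<Rightarrow> nat \<Rightarrow> nat \<Rightarrow> fm \<Rightarrow> bool"
  and Pi_index :: "nat \<Rightarrow> nat \<Rightarrow> nat \<Rightarrow> fm \<Rightarrow> bool" where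
  Sigma_zero: "qf_vars a \<subseteq> {..<k} \<Longrightarrow> Sigma_index 0 k (qf_code a) (QF a)"
| Pi_zero: "qf_vars a \<subseteq> {..<k} \<Longrightarrow> Pi_index 0 k (qf_code a) (QF a)"
| Sigma_pos: "0 < n \<Longrightarrow>
    (\<And>i. i \<in> W e \<Longrightarrow>
      \<exists>l m j \<psi>. i = prod_encode (l, prod_encode (m, j)) \<and> m < n \<and>
        Pi_index m (k + l) j \<psi> \<and> f i = Ex_block k l \<psi>) \<Longrightarrow>
    Sigma_index n k e (Disj (W e) f)"
| Pi_pos: "0 < n \<Longrightarrow>
    (\<And>i. i \<in> W e \<Longrightarrow>
      \<exists>l m j \<psi>. i = prod_encode (l, prod_encode (m, j)) \<and> m < n \<and>
        Sigma_index m (k + l) j \<psi> \<and> f i = All_block k l \<psi>) \<Longrightarrow>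
    Pi_index n k e (Conj (W e) f)"

definition computable_Sigma :: "nat \<Rightarrow> nat \<Rightarrow> fm \<Rightarrow> bool" where
  "computable_Sigma n k \<phi> \<longleftrightarrow> (\<exists>e. Sigma_index n k e \<phi>)"

definition computable_Pi :: "nat \<Rightarrow> nat \<Rightarrow> fm \<Rightarrow> bool" where
  "computable_Pi n k \<phi> \<longleftrightarrow> (\<exists>e. Pi_index n k e \<phi>)"

definition computable_d_Sigma :: "nat \<Rightarrow> nat \<Rightarrow> fm \<Rightarrow> bool" where
  "computable_d_Sigma n k \<phi> \<longleftrightarrow>
     (\<exists>\<psi> \<chi>. computable_Sigma n k \<psi> \<and> computable_Pi n k \<chi> \<and> \<phi> = And \<psi> \<chi>)"

section \<open>Computable structures, Scott sentences, orbits\<close>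

text \<open>
  The atomic diagram of a structure with universe \<open>\<omega>\<close>: the true atomic and negated atomic
  sentences in the language with a constant for each number, where \<open>Var i\<close> serves as the
  constant naming \<open>i\<close>.
\<close>

definition atomic_diagram :: "nat gp_struct \<Rightarrow> qf set" where
  "atomic_diagram M =
     {a. (\<exists>t u. a = Eq t u \<or> a = QNot (Eq t u)) \<and> qf_sat M (\<lambda>i. i) a}"

definition computable_structure :: "nat gp_struct \<Rightarrow> bool" where
  "computable_structure M \<longleftrightarrow>
     carrier M = UNIV \<and> computable_set (qf_code ` atomic_diagram M)"

text \<open>
  Every countable structure is isomorphic to one whose universe is a set of naturals, finite or
  infinite, so it is enough to let \<open>N\<close> range over those.
\<close>

definition scott_sentence :: "'a gp_struct \<Rightarrow> fm \<Rightarrow> bool" where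
  "scott_sentence M \<phi> \<longleftrightarrow>
     sentence \<phi> \<and>
     (\<forall>N :: nat gp_struct. is_structure N \<longrightarrow> (models N \<phi> \<longleftrightarrow> struct_iso M N))"

definition finitely_generated :: "'a monoid \<Rightarrow> bool" where
  "finitely_generated G \<longleftrightarrow>
     (\<exists>S. finite S \<and> S \<subseteq> carrier G \<and> generate G S = carrier G)"

definition generating_tuple :: "'a monoid \<Rightarrow> 'a list \<Rightarrow> bool" where
  "generating_tuple G xs \<longleftrightarrow> set xs \<subseteq> carrier G \<and> generate G (set xs) = carrier G"

definition aut_orbit :: "'a monoid \<Rightarrow> 'a list \<Rightarrow> 'a list set" where
  "aut_orbit G xs = {map h xs | h. h \<in> auto G}"

definition orbit_computable_Pi1 :: "'a monoid \<Rightarrow> 'a list \<Rightarrow> bool" where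
  "orbit_computable_Pi1 G xs \<longleftrightarrow>
     (\<exists>\<phi>. computable_Pi 1 (length xs) \<phi> \<and>
       defined_rel (struct_of_group G) (length xs) \<phi> = aut_orbit G xs)"

end

theory Submission
  imports Defs "HOL-Library.Countable_Set"
begin

text \<open>
  If a \<open>\<Pi>\<^sub>1\<close> formula \<open>\<chi>\<close> defines the orbit of a generating tuple \<open>a\<close>, then \<open>G\<close> is
  characterized by saying that some tuple satisfies \<open>\<chi>\<close> and the (computable) atomic type of
  \<open>a\<close>, and that every tuple satisfying \<open>\<chi>\<close> generates.

  Conversely, let \<open>\<phi>\<close> be a computable \<open>\<Pi>\<^sub>3\<close> Scott sentence. Run a Henkin construction of a
  model of \<open>\<phi>\<close> in which no tuple has the atomic type of \<open>a\<close> and generates; its conditions are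
  computable \<open>\<Pi>\<^sub>1\<close> formulas \<open>p(c)\<close> in the Henkin constants that are satisfiable in \<open>G\<close>. Such
  a model cannot exist, so the construction is stuck at some \<open>p\<close>, for which every realization in
  \<open>G\<close> sends a certain tuple of constants into the orbit of \<open>a\<close>. Since \<open>a\<close> generates, the
  constants can be replaced by words in \<open>a\<close>, which turns \<open>p\<close> into a \<open>\<Pi>\<^sub>1\<close> definition of
  the orbit.
\<close>

section \<open>Computable functions and c.e. sets\<close>

text \<open>Level three fits because an instance of a conjunct of \<open>\<phi>\<close> at constants
  is at most \<open>\<Sigma>\<^sub>2\<close>: choosing a disjunct, with fresh constants as its
  witnesses, adds one computable \<open>\<Pi>\<^sub>1\<close> formula to the condition. No
  effectivity is claimed for the generic set, which serves a contradiction. It matters for the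
  single finite condition at which the construction is stuck, and there it is nonuniform: the
  finitely many words that name its constants form a finite table. Getting stuck can only happen at
  the requirement that a certain tuple of constants be no copy of \<open>a\<close>; all other
  requirements are met inside \<open>G\<close>, because \<open>G\<close> satisfies
  \<open>\<phi>\<close>. An automorphism then moves a realization so that this tuple becomes
  \<open>a\<close> itself, and the words are read off there. In the Scott sentence the orbit formula
  occurs positively under an existential block and negated under a universal one; being
  \<open>\<Pi>\<^sub>1\<close> keeps both parts at level two. Computability of \<open>G\<close>
  makes the atomic type of \<open>a\<close> a c.e. set.\<close>

inductive_cases runs_elims:
  "runs PZero x y" "runs PSuc x y" "runs PFst x y" "runs PSnd x y"
  "runs (PPair p q) x y" "runs (PComp p q) x y" "runs (PRec p q) x y" "runs (PMin p) x y"

text \<open>This makes \<open>runs\<close> a partial function, so a run of a compound program can be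
  compared with known values of its parts. Two results of a minimization cannot differ: the larger
  one demands a positive value where the smaller one has the value 0.\<close>

lemma runs_deterministic: "runs p x y \<Longrightarrow> runs p x y' \<Longrightarrow> y = y'"
proof (induction arbitrary: y' rule: runs.induct)
  case (min p x n)
  have y': "runs p (prod_encode (x, y')) 0" "\<And>i. i < y' \<Longrightarrow> \<exists>z. runs p (prod_encode (x, i)) (Suc z)"
    using min.prems by (auto elim: runs_elims(8))
  show ?case
  proof (rule linorder_cases[of n y'])
    assume "n < y'"
    from y'(2)[OF this] obtain z where "runs p (prod_encode (x, n)) (Suc z)" by blast
    from min.IH(1)[OF this] show ?thesis by simp
  next
    assume "y' < n"
    from min.IH(2)[OF this] obtain z where "\<And>w. runs p (prod_encode (x, y')) w \<Longrightarrow> Suc z = w" by blast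
    from this[OF y'(1)] show ?thesis by simp
  qed
next
  case (comp q x y p z)
  from comp.prems obtain w where "runs q x w" "runs p w y'" by (rule runs_elims(6))
  then show ?case using comp.IH by simp
next
  case (pair p x y q z)
  from pair.prems obtain v w where "y' = prod_encode (v, w)" "runs p x v" "runs q x w"
    by (rule runs_elims(5))
  then show ?case using pair.IH by simp
next
  case (rec_zero p x y q)
  from rec_zero.prems show ?case
    by (rule runs_elims(7)) (use rec_zero.IH in auto)
next
  case (rec_suc p q x n y z)
  from rec_suc.prems show ?case
  proof (rule runs_elims(7))
    fix x' n' w
    assume "prod_encode (x, Suc n) = prod_encode (x', Suc n')"
      and w: "runs (PRec p q) (prod_encode (x', n')) w"
      "runs q (prod_encode (x', prod_encode (n', w))) y'"
    then have "x' = x" "n' = n" by auto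
    with w rec_suc.IH(1)[of w] rec_suc.IH(2)[of y'] show ?thesis by simp
  qed auto
qed (auto elim: runs_elims(1-4))

lemma prog_code_inject: "prog_code p = prog_code q \<longleftrightarrow> p = q"
proof (induction p arbitrary: q)
qed (case_tac q; auto)+

section \<open>Closure properties of the total computable functions\<close>

definition computable :: "(nat \<Rightarrow> nat) \<Rightarrow> bool" where
  "computable f \<longleftrightarrow> (\<exists>p. \<forall>x. runs p x (f x))"

definition ce :: "nat set \<Rightarrow> bool" where
  "ce D \<longleftrightarrow> (\<exists>p. D = {x. \<exists>y. runs p x y})"

named_theorems comp_intros

lemma compI: "(\<And>x. runs p x (f x)) \<Longrightarrow> computable f"
  unfolding computable_def by (intro exI allI)

lemma compD: "computable f \<Longrightarrow> \<exists>p. \<forall>x. runs p x (f x)"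
  unfolding computable_def .

lemma comp_compose:
  assumes "computable f" "computable g" shows "computable (\<lambda>x. f (g x))"
proof -
  obtain p where "\<forall>x. runs p x (f x)" using compD[OF assms(1)] by blast
  then have p: "runs p x (f x)" for x by (rule spec)
  obtain q where "\<forall>x. runs q x (g x)" using compD[OF assms(2)] by blast
  then have q: "runs q x (g x)" for x by (rule spec)
  show ?thesis by (rule compI[of "PComp p q"]) (rule runs.comp[OF q p])
qed

lemma comp_Suc [comp_intros]:
  assumes "computable f" shows "computable (\<lambda>x. Suc (f x))"
  by (rule comp_compose[OF compI[OF runs.suc] assms])

lemma comp_pair [comp_intros]:
  assumes "computable f" "computable g" shows "computable (\<lambda>x. prod_encode (f x, g x))"
proof -
  obtain p where "\<forall>x. runs p x (f x)" using compD[OF assms(1)] by blast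
  then have p: "runs p x (f x)" for x by (rule spec)
  obtain q where "\<forall>x. runs q x (g x)" using compD[OF assms(2)] by blast
  then have q: "runs q x (g x)" for x by (rule spec)
  show ?thesis by (rule compI[of "PPair p q"]) (rule runs.pair[OF p q])
qed

lemma runs_PFst: "runs PFst x (fst (prod_decode x))"
  using runs.first[of "fst (prod_decode x)" "snd (prod_decode x)"] by simp

lemma runs_PSnd: "runs PSnd x (snd (prod_decode x))"
  using runs.second[of "fst (prod_decode x)" "snd (prod_decode x)"] by simp

lemma comp_fst [comp_intros]:
  assumes "computable f" shows "computable (\<lambda>x. fst (prod_decode (f x)))"
  by (rule comp_compose[OF compI[OF runs_PFst] assms])

lemma comp_snd [comp_intros]:
  assumes "computable f" shows "computable (\<lambda>x. snd (prod_decode (f x)))"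
  by (rule comp_compose[OF compI[OF runs_PSnd] assms])

lemma comp_id [comp_intros]: "computable (\<lambda>x. x)"
proof -
  have "runs (PPair PFst PSnd) x x" for x
    using runs.pair[OF runs_PFst[of x] runs_PSnd[of x]] by simp
  then show ?thesis by (rule compI)
qed

lemma comp_const [comp_intros]: "computable (\<lambda>x. n)"
proof (induction n)
  case 0
  show ?case by (rule compI[OF runs.zero])
next
  case (Suc n)
  then show ?case by (rule comp_Suc)
qed

text \<open>\<open>PRec\<close> hands its step program the coded triple of parameter, counter and
  previous value, which the projections in the second assumption unpack. The whole input
  \<open>x\<close> is kept as the parameter, so that base, step and count may all depend on
  it.\<close>

lemma comp_rec:
  assumes b: "computable b" and s: "computable (\<lambda>z. s (fst (prod_decode z)) (fst (prod_decode (snd (prod_decode z))))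
      (snd (prod_decode (snd (prod_decode z)))))" (is "computable ?s") and n: "computable n"
  shows "computable (\<lambda>x. rec_nat (b x) (s x) (n x))"
proof -
  obtain p where "\<forall>x. runs p x (b x)" using compD[OF b] by blast
  then have p: "runs p x (b x)" for x by (rule spec)
  obtain q where "\<forall>x. runs q x (?s x)" using compD[OF s] by blast
  then have q: "runs q x (?s x)" for x by (rule spec)
  have "runs (PRec p q) (prod_encode (x, k)) (rec_nat (b x) (s x) k)" for x k
  proof (induction k)
    case 0
    show ?case using runs.rec_zero[OF p] by simp
  next
    case (Suc k)
    from runs.rec_suc[OF this q[of "prod_encode (x, prod_encode (k, rec_nat (b x) (s x) k))"]]
    show ?case by simp
  qed
  from this[of "fst (prod_decode z)" "snd (prod_decode z)" for z]
  have "computable (\<lambda>z. rec_nat (b (fst (prod_decode z))) (s (fst (prod_decode z))) (snd (prod_decode z)))"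
    by (intro compI[of "PRec p q"]) simp
  from comp_compose[OF this comp_pair[OF comp_id n]] show ?thesis by simp
qed

lemma comp_pred [comp_intros]:
  assumes "computable f" shows "computable (\<lambda>x. f x - 1)"
proof -
  have "computable (\<lambda>x. rec_nat 0 (\<lambda>n y. n) (f x))"
    by (rule comp_rec) (intro comp_intros assms)+
  moreover have "rec_nat 0 (\<lambda>n y. n) m = m - 1" for m :: nat
    by (cases m) auto
  ultimately show ?thesis by simp
qed

lemma comp_diff [comp_intros]:
  assumes "computable f" "computable g" shows "computable (\<lambda>x. f x - g x)"
proof -
  have "computable (\<lambda>x. rec_nat (f x) (\<lambda>n y. y - 1) (g x))"
    by (rule comp_rec) (intro comp_intros assms)+
  moreover have "rec_nat k (\<lambda>n y. y - 1) m = k - m" for k m :: nat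
    by (induction m) auto
  ultimately show ?thesis by simp
qed

lemma comp_add [comp_intros]:
  assumes "computable f" "computable g" shows "computable (\<lambda>x. f x + g x)"
proof -
  have "computable (\<lambda>x. rec_nat (f x) (\<lambda>n y. Suc y) (g x))"
    by (rule comp_rec) (intro comp_intros assms)+
  moreover have "rec_nat k (\<lambda>n y. Suc y) m = k + m" for k m :: nat
    by (induction m) auto
  ultimately show ?thesis by simp
qed

text \<open>Case distinction is a recursion whose step forgets both counter and previous value: only
  whether the count vanishes has an effect.\<close>

lemma comp_if_zero:
  assumes "computable t" "computable f" "computable g"
  shows "computable (\<lambda>x. if t x = 0 then f x else g x)"
proof -
  have "computable (\<lambda>x. rec_nat (f x) (\<lambda>n y. g x) (t x))"
    by (rule comp_rec) (intro comp_intros assms comp_compose[OF assms(3)])+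
  moreover have "rec_nat k (\<lambda>n y. l) m = (if m = 0 then k else l)" for k l m :: nat
    by (cases m) auto
  ultimately show ?thesis by simp
qed

lemma comp_if_eq [comp_intros]:
  assumes "computable t" "computable u" "computable f" "computable g"
  shows "computable (\<lambda>x. if t x = u x then f x else g x)"
proof -
  have "computable (\<lambda>x. if (t x - u x) + (u x - t x) = 0 then f x else g x)"
    by (intro comp_if_zero comp_intros assms)
  moreover have "(t x - u x) + (u x - t x) = 0 \<longleftrightarrow> t x = u x" for x by auto
  ultimately show ?thesis by simp
qed

lemma comp_if_less [comp_intros]:
  assumes "computable t" "computable u" "computable f" "computable g"
  shows "computable (\<lambda>x. if t x < u x then f x else g x)"
proof -
  have "computable (\<lambda>x. if Suc (t x) - u x = 0 then f x else g x)"
    by (intro comp_if_zero comp_intros assms)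
  moreover have "Suc (t x) - u x = 0 \<longleftrightarrow> t x < u x" for x by auto
  ultimately show ?thesis by simp
qed

lemma comp_if_mem:
  assumes D: "computable_set D" and "computable t" "computable f" "computable g"
  shows "computable (\<lambda>x. if t x \<in> D then f x else g x)"
proof -
  have "computable (\<lambda>x. if x \<in> D then 1 else 0)"
    using D unfolding computable_set_def computable_def .
  from comp_compose[OF this \<open>computable t\<close>] have "computable (\<lambda>x. if t x \<in> D then 1 else 0)" .
  then have "computable (\<lambda>x. if (if t x \<in> D then 1 else (0::nat)) = 0 then g x else f x)"
    by (rule comp_if_zero) (intro assms)+
  moreover have "(if (if t x \<in> D then 1 else (0::nat)) = 0 then g x else f x) =
      (if t x \<in> D then f x else g x)" for x by simp
  ultimately show ?thesis by simp
qed

text \<open>The values of \<open>f\<close> below \<open>n\<close> are hard-wired one at a time, so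
  \<open>f\<close> may be any function. This admits finite tables obtained by a choice, such as the
  generators or the words naming constants.\<close>

lemma comp_finite_modification:
  assumes "computable g" shows "computable (\<lambda>x. if x < n then f x else g x)"
proof (induction n)
  case 0
  show ?case using assms by simp
next
  case (Suc n)
  have "computable (\<lambda>x. if x = n then f n else if x < n then f x else g x)"
    by (intro comp_intros Suc)
  moreover have "(if x = n then f n else if x < n then f x else g x) =
      (if x < Suc n then f x else g x)" for x by auto
  ultimately show ?case by simp
qed

subsection \<open>Course-of-values recursion\<close>

primrec history :: "(nat \<Rightarrow> nat) \<Rightarrow> nat \<Rightarrow> nat" where
  "history f 0 = 0"
| "history f (Suc n) = prod_encode (f n, history f n)"

text \<open>The history is a stack with the newest value on top and no stored length: of
  \<open>n\<close> entries, \<open>n - Suc k\<close> must be popped to expose the value at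
  \<open>k\<close>.\<close>

definition lookup :: "nat \<Rightarrow> nat \<Rightarrow> nat \<Rightarrow> nat" where
  "lookup n k h = fst (prod_decode (rec_nat h (\<lambda>i y. snd (prod_decode y)) (n - Suc k)))"

lemma lookup_history:
  assumes "k < n" shows "lookup n k (history f n) = f k"
proof -
  have "rec_nat (history f n) (\<lambda>i y. snd (prod_decode y)) d = history f (n - d)" if "d \<le> n" for d
    using that
  proof (induction d)
    case (Suc d)
    then have "n - d = Suc (n - Suc d)" by simp
    with Suc show ?case by simp
  qed simp
  moreover have "n - (n - Suc k) = Suc k" using assms by simp
  ultimately show ?thesis unfolding lookup_def by simp
qed

lemma comp_lookup [comp_intros]:
  assumes "computable n" "computable k" "computable h" shows "computable (\<lambda>x. lookup (n x) (k x) (h x))"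
  unfolding lookup_def by (intro comp_fst comp_rec comp_intros assms)

text \<open>Primitive recursion runs on the whole history instead of the single value: each step
  pushes the value that \<open>h\<close> computes from the stack.\<close>

lemma comp_course_of_values:
  assumes h: "computable h" and f: "\<And>n. f n = h (prod_encode (n, history f n))"
  shows "computable f"
proof -
  have "computable (\<lambda>n. rec_nat 0 (\<lambda>n y. prod_encode (h (prod_encode (n, y)), y)) n)"
    by (rule comp_rec) (intro comp_intros comp_compose[OF h])+
  moreover have "rec_nat 0 (\<lambda>n y. prod_encode (h (prod_encode (n, y)), y)) n = history f n" for n
    by (induction n) (auto simp: f[symmetric])
  ultimately have "computable (history f)" by simp
  from comp_compose[OF h comp_pair[OF comp_id this]] show ?thesis by (simp add: f[symmetric])
qed

subsection \<open>Closure properties of c.e. sets\<close>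

lemma ceI: "(\<And>x. (\<exists>y. runs p x y) \<longleftrightarrow> x \<in> D) \<Longrightarrow> ce D"
  unfolding ce_def by (intro exI[of _ p]) auto

lemma ce_UNIV: "ce UNIV"
  by (rule ceI[of PZero]) (auto intro: runs.zero)

lemma ce_vimage:
  assumes "ce D" "computable f" shows "ce {x. f x \<in> D}"
proof -
  obtain p where D: "D = {x. \<exists>y. runs p x y}" using assms(1) unfolding ce_def by blast
  obtain q where "\<forall>x. runs q x (f x)" using compD[OF assms(2)] by blast
  then have q: "runs q x (f x)" for x by (rule spec)
  show ?thesis
  proof (rule ceI[of "PComp p q"])
    fix x
    show "(\<exists>y. runs (PComp p q) x y) \<longleftrightarrow> x \<in> {x. f x \<in> D}"
    proof
      assume "\<exists>y. runs (PComp p q) x y"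
      then obtain y where "runs (PComp p q) x y" ..
      then obtain z where z: "runs q x z" "runs p z y" by (rule runs_elims(6))
      from runs_deterministic[OF z(1) q] z(2) show "x \<in> {x. f x \<in> D}" unfolding D by auto
    next
      assume "x \<in> {x. f x \<in> D}"
      then obtain y where "runs p (f x) y" unfolding D by auto
      from runs.comp[OF q this] show "\<exists>y. runs (PComp p q) x y" ..
    qed
  qed
qed

text \<open>\<open>PPair\<close> halts exactly when both its components do.\<close>

lemma ce_Int:
  assumes "ce D" "ce E" shows "ce (D \<inter> E)"
proof -
  obtain p q where "D = {x. \<exists>y. runs p x y}" "E = {x. \<exists>y. runs q x y}"
    using assms unfolding ce_def by blast
  then show ?thesis by (intro ceI[of "PPair p q"]) (auto intro: runs.pair elim!: runs_elims(5))
qed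

text \<open>The condition searched for by \<open>PMin\<close> does not depend on the counter, so the
  search stops at 0 or never.\<close>

lemma ce_eq:
  assumes "computable f" "computable g" shows "ce {x. f x = g x}"
proof -
  have "computable (\<lambda>z. if f (fst (prod_decode z)) = g (fst (prod_decode z)) then 0 else 1)"
    by (intro comp_intros comp_compose[OF assms(1)] comp_compose[OF assms(2)])
  from compD[OF this]
  obtain p where "\<forall>z. runs p z (if f (fst (prod_decode z)) = g (fst (prod_decode z)) then 0 else 1)"
    by blast
  from this[rule_format, of "prod_encode (x, n)" for x n]
  have p: "runs p (prod_encode (x, n)) (if f x = g x then 0 else 1)" for x n by simp
  show ?thesis
  proof (rule ceI[of "PMin p"])
    fix x
    show "(\<exists>y. runs (PMin p) x y) \<longleftrightarrow> x \<in> {x. f x = g x}"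
    proof
      assume "\<exists>y. runs (PMin p) x y"
      then obtain n where "runs (PMin p) x n" ..
      then have "runs p (prod_encode (x, n)) 0" by (rule runs_elims(8))
      from runs_deterministic[OF this p] show "x \<in> {x. f x = g x}" by (simp split: if_splits)
    next
      assume "x \<in> {x. f x = g x}"
      then have "runs p (prod_encode (x, 0)) 0" using p[of x 0] by simp
      then have "runs (PMin p) x 0" by (rule runs.min) simp
      then show "\<exists>y. runs (PMin p) x y" ..
    qed
  qed
qed

text \<open>A conditional built by composition would run \<open>p\<close> at \<open>a\<close> as
  well, where it may diverge. \<open>PRec\<close> runs its step program only if the counter is
  positive; the counter is therefore 0 at \<open>a\<close> and 1 elsewhere, and \<open>p\<close> is
  started in the step.\<close>

lemma ce_insert:
  assumes "ce D" shows "ce (insert a D)"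
proof -
  obtain p where D: "D = {x. \<exists>y. runs p x y}" using assms unfolding ce_def by blast
  let ?p = "PRec PZero (PComp p PFst)"
  have 0: "\<exists>y. runs ?p (prod_encode (x, 0)) y" for x
    using runs.rec_zero[OF runs.zero] by (rule exI)
  have 1: "(\<exists>y. runs ?p (prod_encode (x, Suc 0)) y) \<longleftrightarrow> x \<in> D" for x
  proof
    assume "\<exists>y. runs ?p (prod_encode (x, Suc 0)) y"
    then obtain y where "runs ?p (prod_encode (x, Suc 0)) y" ..
    then obtain z where "runs (PComp p PFst) (prod_encode (x, z)) y"
      by (rule runs_elims(7)) auto
    then obtain w where w: "runs PFst (prod_encode (x, z)) w" "runs p w y" by (rule runs_elims(6))
    from runs_deterministic[OF w(1) runs.first] w(2) show "x \<in> D" unfolding D by auto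
  next
    assume "x \<in> D"
    then obtain y where "runs p x y" unfolding D by blast
    from runs.rec_suc[OF runs.rec_zero[OF runs.zero] runs.comp[OF runs.first this]]
    have "runs ?p (prod_encode (x, Suc 0)) y" .
    then show "\<exists>y. runs ?p (prod_encode (x, Suc 0)) y" ..
  qed
  have "ce {x. \<exists>y. runs ?p x y}" by (intro ceI) auto
  moreover have "computable (\<lambda>x. prod_encode (x, if x = a then 0 else Suc 0))"
    by (intro comp_intros)
  ultimately have "ce {x. prod_encode (x, if x = a then 0 else Suc 0) \<in> {x. \<exists>y. runs ?p x y}}"
    by (rule ce_vimage)
  also have "{x. prod_encode (x, if x = a then 0 else Suc 0) \<in> {x. \<exists>y. runs ?p x y}} = insert a D"
    using 0 1 by auto
  finally show ?thesis .
qed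

lemma ce_empty: "ce {}"
  using ce_eq[OF comp_const[of 0] comp_const[of 1]] by simp

lemma ce_W: "ce (W e)"
proof (cases "\<exists>p. prog_code p = e")
  case True
  then obtain p where "e = prog_code p" by blast
  then show ?thesis unfolding W_def by (intro ceI[of p]) (auto simp: prog_code_inject)
next
  case False
  then have "W e = {}" unfolding W_def by blast
  then show ?thesis using ce_empty by simp
qed

lemma ce_imp_W:
  assumes "ce D" obtains e where "W e = D"
proof -
  obtain p where "D = {x. \<exists>y. runs p x y}" using assms unfolding ce_def by blast
  then have "W (prog_code p) = D" unfolding W_def by (auto simp: prog_code_inject)
  then show thesis by (rule that)
qed

section \<open>Computable operations on terms and formulas\<close>

text \<open>The decoder is total, reading every tag above 2 as \<open>Mul\<close>. All numbers thus
  enumerate terms, and no test for being a code is involved.\<close>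

function tm_of :: "nat \<Rightarrow> tm" where
  "tm_of n = (let m = snd (prod_decode n) in
     if fst (prod_decode n) = 0 then Var m
     else if fst (prod_decode n) = 1 then One
     else if fst (prod_decode n) = 2 then Inv (tm_of m)
     else Mul (tm_of (fst (prod_decode m))) (tm_of (snd (prod_decode m))))"
  by auto

text \<open>The tag has to be positive: 0 is the code of the pair of zeros, so there the second
  component is not smaller. Tag 0 marks the cases in which the decoders do not recurse.\<close>

lemma snd_prod_decode_less: "0 < fst (prod_decode n) \<Longrightarrow> snd (prod_decode n) < n"
proof -
  assume "0 < fst (prod_decode n)"
  obtain a b where ab: "prod_decode n = (a, b)" by fastforce
  then have "n = prod_encode (a, b)" by (metis prod_decode_inverse)
  moreover have "0 < a" using ab \<open>0 < fst (prod_decode n)\<close> by simp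
  then have "b < triangle (a + b) + a"
    by (cases a) (auto simp: triangle_def)
  ultimately show ?thesis using ab by (simp add: prod_encode_def)
qed

lemma fst_prod_decode_le: "fst (prod_decode n) \<le> n"
  by (metis le_prod_encode_1 prod.collapse prod_decode_inverse)

lemma snd_prod_decode_le: "snd (prod_decode n) \<le> n"
  by (metis le_prod_encode_2 prod.collapse prod_decode_inverse)

lemma prod_decode_sub_less:
  assumes "0 < fst (prod_decode n)"
  shows "fst (prod_decode (snd (prod_decode n))) < n" "snd (prod_decode (snd (prod_decode n))) < n"
  using snd_prod_decode_less[OF assms] fst_prod_decode_le snd_prod_decode_le le_less_trans by blast+

termination tm_of
  by (relation "measure (\<lambda>n. n)") (auto intro: snd_prod_decode_less prod_decode_sub_less)

function qf_of :: "nat \<Rightarrow> qf" where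
  "qf_of n = (let m = snd (prod_decode n) in
     if fst (prod_decode n) = 0 then Eq (tm_of (fst (prod_decode m))) (tm_of (snd (prod_decode m)))
     else if fst (prod_decode n) = 1 then QNot (qf_of m)
     else if fst (prod_decode n) = 2 then QAnd (qf_of (fst (prod_decode m))) (qf_of (snd (prod_decode m)))
     else QOr (qf_of (fst (prod_decode m))) (qf_of (snd (prod_decode m))))"
  by auto

termination qf_of
  by (relation "measure (\<lambda>n. n)") (auto intro: snd_prod_decode_less prod_decode_sub_less)

declare tm_of.simps [simp del] qf_of.simps [simp del]

lemma tm_of_tm_code [simp]: "tm_of (tm_code t) = t"
  by (induction t; subst tm_of.simps) (simp_all add: Let_def)

lemma qf_of_qf_code [simp]: "qf_of (qf_code a) = a"
  by (induction a; subst qf_of.simps) (simp_all add: Let_def)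

section \<open>Substitution of terms for variables and its computability\<close>

primrec tm_subst :: "(nat \<Rightarrow> tm) \<Rightarrow> tm \<Rightarrow> tm" where
  "tm_subst \<tau> (Var i) = \<tau> i"
| "tm_subst \<tau> One = One"
| "tm_subst \<tau> (Inv t) = Inv (tm_subst \<tau> t)"
| "tm_subst \<tau> (Mul t u) = Mul (tm_subst \<tau> t) (tm_subst \<tau> u)"

primrec qf_subst :: "(nat \<Rightarrow> tm) \<Rightarrow> qf \<Rightarrow> qf" where
  "qf_subst \<tau> (Eq t u) = Eq (tm_subst \<tau> t) (tm_subst \<tau> u)"
| "qf_subst \<tau> (QNot a) = QNot (qf_subst \<tau> a)"
| "qf_subst \<tau> (QAnd a b) = QAnd (qf_subst \<tau> a) (qf_subst \<tau> b)"
| "qf_subst \<tau> (QOr a b) = QOr (qf_subst \<tau> a) (qf_subst \<tau> b)"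

lemma tm_val_subst: "tm_val M s (tm_subst \<tau> t) = tm_val M (\<lambda>i. tm_val M s (\<tau> i)) t"
  by (induction t) auto

lemma qf_sat_subst: "qf_sat M s (qf_subst \<tau> a) \<longleftrightarrow> qf_sat M (\<lambda>i. tm_val M s (\<tau> i)) a"
  by (induction a) (auto simp: tm_val_subst)

lemma tm_vars_subst: "tm_vars (tm_subst \<tau> t) = (\<Union>i\<in>tm_vars t. tm_vars (\<tau> i))"
  by (induction t) auto

lemma tm_subst_Var [simp]: "tm_subst Var t = t"
  by (induction t) auto

lemma tm_subst_cong: "(\<And>i. i \<in> tm_vars t \<Longrightarrow> \<sigma> i = \<tau> i) \<Longrightarrow> tm_subst \<sigma> t = tm_subst \<tau> t"
  by (induction t) auto

lemma qf_subst_Var [simp]: "qf_subst Var a = a"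
  by (induction a) auto

lemma tm_val_cong: "(\<And>i. i \<in> tm_vars t \<Longrightarrow> s i = s' i) \<Longrightarrow> tm_val M s t = tm_val M s' t"
  by (induction t) auto

lemma qf_sat_cong:
  "(\<And>i. i \<in> qf_vars a \<Longrightarrow> s i = s' i) \<Longrightarrow> qf_sat M s a \<longleftrightarrow> qf_sat M s' a"
proof (induction a)
  case (Eq t u)
  then show ?case using tm_val_cong[of t s s' M] tm_val_cong[of u s s' M] by simp
qed auto

text \<open>Serves to find a quantifier block, computable from the code, that is long enough to bind
  every variable of a matrix.\<close>

lemma tm_vars_less_code: "i \<in> tm_vars t \<Longrightarrow> i \<le> tm_code t"
  by (induction t) (auto intro: le_trans[OF _ le_prod_encode_1] le_trans[OF _ le_prod_encode_2])

lemma qf_vars_less_code: "i \<in> qf_vars a \<Longrightarrow> i \<le> qf_code a"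
  by (induction a) (auto dest: tm_vars_less_code
      intro: le_trans[OF _ le_prod_encode_1] le_trans[OF _ le_prod_encode_2])

text \<open>Immediate subterms have smaller codes, so this is a course-of-values recursion. The
  argument \<open>z\<close> of \<open>h\<close> pairs \<open>n\<close> with the history below
  \<open>n\<close>, in which \<open>l\<close> and \<open>r\<close> find the results for the two
  subterms.\<close>

lemma comp_tm_subst:
  assumes "computable (\<lambda>i. tm_code (\<tau> i))"
  shows "computable (\<lambda>n. tm_code (tm_subst \<tau> (tm_of n)))" (is "computable ?f")
proof -
  define tag arg l r where "tag = (\<lambda>z. fst (prod_decode (fst (prod_decode z))))"
    and "arg = (\<lambda>z. snd (prod_decode (fst (prod_decode z))))"
    and "l = (\<lambda>z. lookup (fst (prod_decode z)) (fst (prod_decode (arg z))) (snd (prod_decode z)))"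
    and "r = (\<lambda>z. lookup (fst (prod_decode z)) (snd (prod_decode (arg z))) (snd (prod_decode z)))"
  define h where "h = (\<lambda>z. if tag z = 0 then tm_code (\<tau> (arg z)) else if tag z = 1 then tm_code One
    else if tag z = 2 then prod_encode (2, lookup (fst (prod_decode z)) (arg z) (snd (prod_decode z)))
    else prod_encode (3, prod_encode (l z, r z)))"
  show ?thesis
  proof (rule comp_course_of_values[of h])
    show "computable h"
      unfolding h_def tag_def arg_def l_def r_def by (intro comp_intros comp_compose[OF assms])
    show "?f n = h (prod_encode (n, history ?f n))" for n
      by (subst tm_of.simps)
        (auto simp: h_def tag_def arg_def l_def r_def Let_def lookup_history snd_prod_decode_less
          prod_decode_sub_less)
  qed
qed

lemma comp_qf_subst:
  assumes "computable (\<lambda>i. tm_code (\<tau> i))"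
  shows "computable (\<lambda>n. qf_code (qf_subst \<tau> (qf_of n)))" (is "computable ?f")
proof -
  define tag arg l r where "tag = (\<lambda>z. fst (prod_decode (fst (prod_decode z))))"
    and "arg = (\<lambda>z. snd (prod_decode (fst (prod_decode z))))"
    and "l = (\<lambda>z. lookup (fst (prod_decode z)) (fst (prod_decode (arg z))) (snd (prod_decode z)))"
    and "r = (\<lambda>z. lookup (fst (prod_decode z)) (snd (prod_decode (arg z))) (snd (prod_decode z)))"
  define tl tr where "tl = (\<lambda>z. tm_code (tm_subst \<tau> (tm_of (fst (prod_decode (arg z))))))"
    and "tr = (\<lambda>z. tm_code (tm_subst \<tau> (tm_of (snd (prod_decode (arg z))))))"
  define h where "h = (\<lambda>z. if tag z = 0 then prod_encode (0, prod_encode (tl z, tr z))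
    else if tag z = 1 then prod_encode (1, lookup (fst (prod_decode z)) (arg z) (snd (prod_decode z)))
    else if tag z = 2 then prod_encode (2, prod_encode (l z, r z))
    else prod_encode (3, prod_encode (l z, r z)))"
  show ?thesis
  proof (rule comp_course_of_values[of h])
    show "computable h"
      unfolding h_def tag_def arg_def l_def r_def tl_def tr_def
      by (intro comp_intros comp_compose[OF comp_tm_subst[OF assms]])
    show "?f n = h (prod_encode (n, history ?f n))" for n
      by (subst qf_of.simps)
        (auto simp: h_def tag_def arg_def l_def r_def tl_def tr_def Let_def lookup_history
          snd_prod_decode_less prod_decode_sub_less)
  qed
qed

section \<open>Universal theories given by c.e. sets\<close>

text \<open>Domain and map are kept apart: syntactic operations are composed with \<open>f\<close>
  and leave \<open>D\<close> alone. Proving the image itself c.e. would in general call for an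
  unbounded search.\<close>

definition ce_qf :: "qf set \<Rightarrow> bool" where
  "ce_qf A \<longleftrightarrow> (\<exists>D f. ce D \<and> computable (\<lambda>x. qf_code (f x)) \<and> A = f ` D)"

lemma ce_qfI: "ce D \<Longrightarrow> computable (\<lambda>x. qf_code (f x)) \<Longrightarrow> ce_qf (f ` D)"
  unfolding ce_qf_def by (rule exI[of _ D], rule exI[of _ f]) simp

lemma ce_qf_range: "computable (\<lambda>x. qf_code (f x)) \<Longrightarrow> ce_qf (range f)"
  by (rule ce_qfI[OF ce_UNIV])

lemma ce_qf_singleton: "ce_qf {a}"
  using ce_qf_range[of "\<lambda>x. a"] by (simp add: comp_const)

lemma ce_qf_subst:
  assumes "ce_qf A" and \<tau>: "computable (\<lambda>i. tm_code (\<tau> i))"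
  shows "ce_qf (qf_subst \<tau> ` A)"
proof -
  obtain D f where D: "ce D" and f: "computable (\<lambda>x. qf_code (f x))" and A: "A = f ` D"
    using assms(1) unfolding ce_qf_def by blast
  have "computable (\<lambda>x. qf_code (qf_subst \<tau> (f x)))"
    using comp_compose[OF comp_qf_subst[OF \<tau>] f] by simp
  from ce_qfI[OF D this] show ?thesis unfolding A by (simp add: image_image)
qed

lemma ce_qf_QNot:
  assumes "ce_qf A" shows "ce_qf (QNot ` A)"
proof -
  obtain D f where D: "ce D" and f: "computable (\<lambda>x. qf_code (f x))" and A: "A = f ` D"
    using assms(1) unfolding ce_qf_def by blast
  have "computable (\<lambda>x. qf_code (QNot (f x)))"
    unfolding qf_code.simps by (intro comp_intros f)
  from ce_qfI[OF D this] show ?thesis unfolding A by (simp add: image_image)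
qed

lemma ce_qf_pairs:
  assumes "ce_qf A" "ce_qf B"
    and c: "\<And>a b. qf_code (c a b) = prod_encode (n, prod_encode (qf_code a, qf_code b))"
  shows "ce_qf {c a b | a b. a \<in> A \<and> b \<in> B}"
proof -
  obtain D f where D: "ce D" and f: "computable (\<lambda>x. qf_code (f x))" and A: "A = f ` D"
    using assms(1) unfolding ce_qf_def by blast
  obtain E g where E: "ce E" and g: "computable (\<lambda>x. qf_code (g x))" and B: "B = g ` E"
    using assms(2) unfolding ce_qf_def by blast
  let ?DE = "{z. fst (prod_decode z) \<in> D} \<inter> {z. snd (prod_decode z) \<in> E}"
  let ?h = "\<lambda>z. c (f (fst (prod_decode z))) (g (snd (prod_decode z)))"
  have "ce ?DE" by (intro ce_Int ce_vimage D E comp_intros)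
  moreover have "computable (\<lambda>z. qf_code (?h z))"
    unfolding c by (intro comp_intros comp_compose[OF f] comp_compose[OF g])
  ultimately have "ce_qf (?h ` ?DE)" by (rule ce_qfI)
  also have "?h ` ?DE = {c a b | a b. a \<in> A \<and> b \<in> B}"
  proof (intro equalityI subsetI)
    fix y assume "y \<in> {c a b | a b. a \<in> A \<and> b \<in> B}"
    then obtain u v where "y = c (f u) (g v)" "u \<in> D" "v \<in> E" unfolding A B by blast
    then have "prod_encode (u, v) \<in> ?DE" "y = ?h (prod_encode (u, v))" by auto
    then show "y \<in> ?h ` ?DE" by blast
  qed (auto simp: A B)
  finally show ?thesis .
qed

lemma ce_qf_QAnd: "ce_qf A \<Longrightarrow> ce_qf B \<Longrightarrow> ce_qf {QAnd a b | a b. a \<in> A \<and> b \<in> B}"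
  by (rule ce_qf_pairs) auto

lemma ce_qf_QOr: "ce_qf A \<Longrightarrow> ce_qf B \<Longrightarrow> ce_qf {QOr a b | a b. a \<in> A \<and> b \<in> B}"
  by (rule ce_qf_pairs) auto

definition extends :: "'a gp_struct \<Rightarrow> nat \<Rightarrow> (nat \<Rightarrow> 'a) \<Rightarrow> (nat \<Rightarrow> 'a) \<Rightarrow> bool" where
  "extends M r s s' \<longleftrightarrow> (\<forall>i<r. s' i = s i) \<and> (\<forall>i\<ge>r. s' i \<in> carrier M)"

text \<open>This is the truth of a \<open>\<Pi>\<^sub>1\<close> formula with free variables below
  \<open>r\<close> and matrices \<open>A\<close>. Binding all variables from \<open>r\<close> on at
  once spares any record of the length of each quantifier block.\<close>

definition univ_sat :: "'a gp_struct \<Rightarrow> nat \<Rightarrow> (nat \<Rightarrow> 'a) \<Rightarrow> qf set \<Rightarrow> bool" where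
  "univ_sat M r s A \<longleftrightarrow> (\<forall>s'. extends M r s s' \<longrightarrow> (\<forall>a\<in>A. qf_sat M s' a))"

lemma extends_exists:
  assumes "carrier M \<noteq> {}" obtains s' where "extends M r s s'"
proof -
  obtain x where "x \<in> carrier M" using assms by blast
  then have "extends M r s (\<lambda>i. if i < r then s i else x)" unfolding extends_def by simp
  then show thesis by (rule that)
qed

lemma extends_cong: "(\<And>i. i < r \<Longrightarrow> s i = t i) \<Longrightarrow> extends M r s s' \<longleftrightarrow> extends M r t s'"
  unfolding extends_def by auto

lemma univ_sat_cong: "(\<And>i. i < r \<Longrightarrow> s i = t i) \<Longrightarrow> univ_sat M r s A \<longleftrightarrow> univ_sat M r t A"
  unfolding univ_sat_def using extends_cong[of r s t M] by simp

lemma univ_sat_closed: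
  assumes "carrier M \<noteq> {}" and "\<And>a. a \<in> A \<Longrightarrow> qf_vars a \<subseteq> {..<r}"
  shows "univ_sat M r s A \<longleftrightarrow> (\<forall>a\<in>A. qf_sat M s a)"
proof -
  have eq: "qf_sat M s' a \<longleftrightarrow> qf_sat M s a" if "extends M r s s'" "a \<in> A" for s' a
  proof (rule qf_sat_cong)
    fix i assume "i \<in> qf_vars a"
    with assms(2)[OF that(2)] have "i < r" by auto
    with that(1) show "s' i = s i" by (simp add: extends_def)
  qed
  obtain s' where "extends M r s s'" using assms(1) by (rule extends_exists)
  with eq show ?thesis unfolding univ_sat_def by auto
qed

lemma univ_sat_QAnd:
  assumes "A \<noteq> {}" "B \<noteq> {}"
  shows "univ_sat M r s {QAnd a b | a b. a \<in> A \<and> b \<in> B} \<longleftrightarrow> univ_sat M r s A \<and> univ_sat M r s B"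
proof -
  let ?C = "{QAnd a b | a b. a \<in> A \<and> b \<in> B}"
  have "(\<forall>c\<in>?C. qf_sat M s' c) \<longleftrightarrow> (\<forall>a\<in>A. qf_sat M s' a) \<and> (\<forall>b\<in>B. qf_sat M s' b)" for s'
  proof
    assume l: "\<forall>c\<in>?C. qf_sat M s' c"
    have "qf_sat M s' a \<and> qf_sat M s' b" if "a \<in> A" "b \<in> B" for a b
    proof -
      have "QAnd a b \<in> ?C" using that by blast
      with l have "qf_sat M s' (QAnd a b)" by (rule bspec)
      then show ?thesis by simp
    qed
    with assms show "(\<forall>a\<in>A. qf_sat M s' a) \<and> (\<forall>b\<in>B. qf_sat M s' b)" by blast
  qed auto
  then show ?thesis unfolding univ_sat_def by (simp only: imp_conjR all_conj_distrib)
qed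

text \<open>
  Taking conjunctions of pairs, instead of the union of the two sets, avoids having to run two
  programs in parallel; it needs nonempty sets, which is why empty sets are padded by a tautology.
\<close>

lemma ce_qf_nonempty:
  assumes "ce_qf A"
  obtains B where "ce_qf B" "B \<noteq> {}" "\<forall>(M::'a gp_struct) r s. univ_sat M r s B \<longleftrightarrow> univ_sat M r s A"
proof (cases "A = {}")
  case True
  then have "\<forall>(M::'a gp_struct) r s. univ_sat M r s {Eq One One} \<longleftrightarrow> univ_sat M r s A"
    by (simp add: univ_sat_def)
  with ce_qf_singleton show thesis by (intro that) auto
next
  case False
  with assms show thesis by (intro that) auto
qed

lemma ce_qf_conj:
  assumes "ce_qf A" "ce_qf B"
  obtains C where "ce_qf C"
    "\<forall>(M::'a gp_struct) r s. univ_sat M r s C \<longleftrightarrow> univ_sat M r s A \<and> univ_sat M r s B"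
proof -
  obtain A' where A': "ce_qf A'" "A' \<noteq> {}"
    "\<forall>(M::'a gp_struct) r s. univ_sat M r s A' \<longleftrightarrow> univ_sat M r s A"
    using assms(1) by (rule ce_qf_nonempty)
  obtain B' where B': "ce_qf B'" "B' \<noteq> {}"
    "\<forall>(M::'a gp_struct) r s. univ_sat M r s B' \<longleftrightarrow> univ_sat M r s B"
    using assms(2) by (rule ce_qf_nonempty)
  show thesis
  proof (rule that)
    show "ce_qf {QAnd a b | a b. a \<in> A' \<and> b \<in> B'}" using A'(1) B'(1) by (rule ce_qf_QAnd)
    show "\<forall>(M::'a gp_struct) r s. univ_sat M r s {QAnd a b | a b. a \<in> A' \<and> b \<in> B'} \<longleftrightarrow>
        univ_sat M r s A \<and> univ_sat M r s B"
      unfolding univ_sat_QAnd[OF A'(2) B'(2)] using A'(3) B'(3) by simp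
  qed
qed

lemma ce_qf_conj_list:
  assumes "\<And>A. A \<in> set As \<Longrightarrow> ce_qf A"
  shows "\<exists>C. ce_qf C \<and>
    (\<forall>(M::'a gp_struct) r s. univ_sat M r s C \<longleftrightarrow> (\<forall>A\<in>set As. univ_sat M r s A))"
  using assms
proof (induction As)
  case Nil
  show ?case by (rule exI[of _ "{Eq One One}"]) (simp add: univ_sat_def ce_qf_singleton)
next
  case (Cons A As)
  then obtain C where "ce_qf C"
    and C: "\<forall>(M::'a gp_struct) r s. univ_sat M r s C \<longleftrightarrow> (\<forall>A\<in>set As. univ_sat M r s A)" by auto
  from Cons.prems[of A] have "ce_qf A" by simp
  then obtain C' where "ce_qf C'"
    "\<forall>(M::'a gp_struct) r s. univ_sat M r s C' \<longleftrightarrow> univ_sat M r s A \<and> univ_sat M r s C"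
    using \<open>ce_qf C\<close> by (rule ce_qf_conj)
  then show ?case using C by (intro exI[of _ C']) simp
qed

section \<open>Semantics of quantifier blocks and of computable formulas\<close>

lemma sat_foldr_All:
  "sat M (foldr All xs \<psi>) s \<longleftrightarrow>
    (\<forall>s'. (\<forall>i. i \<notin> set xs \<longrightarrow> s' i = s i) \<longrightarrow> (\<forall>i\<in>set xs. s' i \<in> carrier M) \<longrightarrow> sat M \<psi> s')"
proof (induction xs arbitrary: s)
  case Nil
  then show ?case by (auto simp flip: fun_eq_iff)
next
  case (Cons x xs)
  show ?case (is "?l \<longleftrightarrow> ?r")
  proof
    assume ?l
    show ?r
    proof (intro allI impI)
      fix s' assume s': "\<forall>i. i \<notin> set (x # xs) \<longrightarrow> s' i = s i" "\<forall>i\<in>set (x # xs). s' i \<in> carrier M"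
      then have "sat M (foldr All xs \<psi>) (s(x := s' x))" using \<open>?l\<close> by simp
      then show "sat M \<psi> s'" using s' unfolding Cons.IH by auto
    qed
  next
    assume r: ?r
    have "sat M \<psi> s'" if "y \<in> carrier M" "\<forall>i. i \<notin> set xs \<longrightarrow> s' i = (s(x := y)) i"
      "\<forall>i\<in>set xs. s' i \<in> carrier M" for y s'
    proof -
      \<comment> \<open>If \<open>x\<close> occurs again in \<open>xs\<close>, the inner quantifier
        rebinds it, and \<open>s' x\<close> need not be \<open>y\<close>.\<close>
      have "s' x \<in> carrier M" using that by (cases "x \<in> set xs") auto
      with that r show ?thesis by auto
    qed
    then show ?l by (simp add: Cons.IH)
  qed
qed

lemma sat_foldr_Ex:
  "sat M (foldr Ex xs \<psi>) s \<longleftrightarrow>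
    (\<exists>s'. (\<forall>i. i \<notin> set xs \<longrightarrow> s' i = s i) \<and> (\<forall>i\<in>set xs. s' i \<in> carrier M) \<and> sat M \<psi> s')"
proof -
  have "sat M (foldr Ex xs \<psi>) s \<longleftrightarrow> \<not> sat M (foldr All xs (Neg \<psi>)) s" for s
    by (induction xs arbitrary: s) auto
  then show ?thesis unfolding sat_foldr_All by auto
qed

lemma sat_All_block:
  "sat M (All_block k l \<psi>) s \<longleftrightarrow>
    (\<forall>s'. (\<forall>i. i < k \<or> k + l \<le> i \<longrightarrow> s' i = s i) \<longrightarrow> (\<forall>i\<in>{k..<k + l}. s' i \<in> carrier M) \<longrightarrow> sat M \<psi> s')"
  unfolding All_block_def sat_foldr_All by (simp add: not_le not_less)

lemma sat_Ex_block:
  "sat M (Ex_block k l \<psi>) s \<longleftrightarrow>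
    (\<exists>s'. (\<forall>i. i < k \<or> k + l \<le> i \<longrightarrow> s' i = s i) \<and> (\<forall>i\<in>{k..<k + l}. s' i \<in> carrier M) \<and> sat M \<psi> s')"
  unfolding Ex_block_def sat_foldr_Ex by (simp add: not_le not_less)

text \<open>The block binds \<open>l\<close> variables, \<open>univ_sat\<close> every variable from
  \<open>k\<close> on. The two agree since \<open>a\<close> has no variable beyond the block, so
  assignments may be changed there freely.\<close>

lemma sat_All_block_QF:
  assumes "carrier M \<noteq> {}" "qf_vars a \<subseteq> {..<k + l}"
  shows "sat M (All_block k l (QF a)) s \<longleftrightarrow> univ_sat M k s {a}"
proof
  assume l: "sat M (All_block k l (QF a)) s"
  show "univ_sat M k s {a}" unfolding univ_sat_def
  proof (intro allI impI)
    fix s' assume s': "extends M k s s'"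
    let ?s = "\<lambda>i. if i < k \<or> k + l \<le> i then s i else s' i"
    have "qf_sat M ?s a" using l s' unfolding sat_All_block extends_def by simp
    also have "qf_sat M ?s a \<longleftrightarrow> qf_sat M s' a"
      using s' assms(2) by (intro qf_sat_cong) (auto simp: extends_def)
    finally show "\<forall>a\<in>{a}. qf_sat M s' a" by simp
  qed
next
  assume r: "univ_sat M k s {a}"
  show "sat M (All_block k l (QF a)) s" unfolding sat_All_block
  proof (intro allI impI)
    fix s' assume s': "\<forall>i. i < k \<or> k + l \<le> i \<longrightarrow> s' i = s i" "\<forall>i\<in>{k..<k + l}. s' i \<in> carrier M"
    obtain t where t: "extends M (k + l) s' t" using extends_exists[OF assms(1)] .
    have "extends M k s t" using s' t unfolding extends_def by (metis atLeastLessThan_iff le_add1 not_le order_less_le_trans)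
    with r have "qf_sat M t a" unfolding univ_sat_def by simp
    also have "qf_sat M t a \<longleftrightarrow> qf_sat M s' a"
      using t assms(2) by (intro qf_sat_cong) (auto simp: extends_def)
    finally show "sat M (QF a) s'" by simp
  qed
qed

lemma sat_Ex_block_QF:
  assumes "carrier M \<noteq> {}" "qf_vars a \<subseteq> {..<k + l}"
  shows "sat M (Ex_block k l (QF a)) s \<longleftrightarrow> (\<exists>s'. extends M k s s' \<and> qf_sat M s' a)"
proof -
  have "sat M (Ex_block k l (QF a)) s \<longleftrightarrow> \<not> sat M (All_block k l (QF (QNot a))) s"
    unfolding sat_All_block sat_Ex_block by auto
  also have "\<dots> \<longleftrightarrow> \<not> univ_sat M k s {QNot a}"
    using sat_All_block_QF[OF assms(1), of "QNot a"] assms(2) by simp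
  finally show ?thesis unfolding univ_sat_def by auto
qed

lemma index_free_vars:
  "Sigma_index n k e \<phi> \<Longrightarrow> free_vars \<phi> \<subseteq> {..<k}"
  "Pi_index n k e \<psi> \<Longrightarrow> free_vars \<psi> \<subseteq> {..<k}"
proof (induction rule: Sigma_index_Pi_index.inducts)
  case (Sigma_pos n e k f)
  have "free_vars (foldr Ex xs \<psi>) = free_vars \<psi> - set xs" for xs \<psi>
    by (induction xs) auto
  with Sigma_pos.IH show ?case by (fastforce simp: Ex_block_def)
next
  case (Pi_pos n e k f)
  have "free_vars (foldr All xs \<psi>) = free_vars \<psi> - set xs" for xs \<psi>
    by (induction xs) auto
  with Pi_pos.IH show ?case by (fastforce simp: All_block_def)
qed auto

text \<open>
  The indices of the disjuncts or conjuncts built from a c.e. set of quantifier-free formulas: the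
  length of the quantifier block is chosen so large that it determines the argument \<open>x\<close>, so
  that membership in the set of all these indices can be tested without an unbounded search.
\<close>

lemma ce_qf_indices:
  assumes "ce_qf A"
  obtains e l g and D :: "nat set" where "W e = (\<lambda>x. prod_encode (l x, prod_encode (0, qf_code (g x)))) ` D"
    "inj l" "g ` D = A" "\<forall>x. \<forall>i\<in>qf_vars (g x). i < l x"
proof -
  obtain D f where D: "ce D" and f: "computable (\<lambda>x. qf_code (f x))" and A: "A = f ` D"
    using assms unfolding ce_qf_def by blast
  \<comment> \<open>\<open>Suc\<close> puts the length above every variable of the matrix, since
    these are at most its code. The pairing makes \<open>?l\<close> injective and lets
    \<open>?x\<close> read \<open>x\<close> off again.\<close>
  let ?l = "\<lambda>x. Suc (prod_encode (x, qf_code (f x)))"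
  let ?i = "\<lambda>x. prod_encode (?l x, prod_encode (0, qf_code (f x)))"
  let ?x = "\<lambda>y. fst (prod_decode (fst (prod_decode y) - 1))"
  have "computable ?x" by (intro comp_intros)
  moreover have "computable ?i" by (intro comp_intros f)
  \<comment> \<open>An index is recognized by decoding a candidate \<open>x\<close> from it and
    encoding that again.\<close>
  ultimately have "ce ({y. ?x y \<in> D} \<inter> {y. ?i (?x y) = y})"
    by (intro ce_Int ce_vimage[OF D] ce_eq comp_compose[of ?i ?x] comp_id)
  also have "{y. ?x y \<in> D} \<inter> {y. ?i (?x y) = y} = ?i ` D"
    by (auto simp: image_iff) (metis)
  finally obtain e where "W e = ?i ` D" by (rule ce_imp_W)
  moreover have "inj ?l" by (auto intro: injI)
  moreover have "i < ?l x" if "i \<in> qf_vars (f x)" for i x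
    using qf_vars_less_code[OF that] le_prod_encode_2[of "qf_code (f x)" x] by simp
  ultimately show thesis using A by (intro that[of e ?l f D]) auto
qed

lemma computable_Pi1_exists:
  assumes "ce_qf A"
  obtains \<phi> where "computable_Pi 1 k \<phi>"
    "\<forall>(M::'a gp_struct) s. carrier M \<noteq> {} \<longrightarrow> (sat M \<phi> s \<longleftrightarrow> univ_sat M k s A)"
proof -
  obtain e l g and D :: "nat set"
    where W: "W e = (\<lambda>x. prod_encode (l x, prod_encode (0, qf_code (g x)))) ` D"
      and l: "inj l" and g: "g ` D = A" "\<forall>x. \<forall>i\<in>qf_vars (g x). i < l x"
    using assms by (rule ce_qf_indices)
  \<comment> \<open>The family is indexed by the coded triples, so the matrix is recovered from the
    block length, which determines \<open>x\<close>.\<close>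
  define f where "f = (\<lambda>i. let x = inv_into UNIV l (fst (prod_decode i)) in All_block k (l x) (QF (g x)))"
  have f: "f (prod_encode (l x, j)) = All_block k (l x) (QF (g x))" for x j
    unfolding f_def using inv_into_f_f[OF l UNIV_I] by (simp add: Let_def)
  have vars: "qf_vars (g x) \<subseteq> {..<k + l x}" for x using g(2) by fastforce
  have "Pi_index 1 k e (Conj (W e) f)"
  proof (rule Pi_pos)
    fix i assume "i \<in> W e"
    then obtain x where "x \<in> D" "i = prod_encode (l x, prod_encode (0, qf_code (g x)))"
      unfolding W by blast
    with Sigma_zero[OF vars[of x]] f
    show "\<exists>l m j \<psi>. i = prod_encode (l, prod_encode (m, j)) \<and> m < 1 \<and>
      Sigma_index m (k + l) j \<psi> \<and> f i = All_block k l \<psi>" by blast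
  qed simp
  moreover have "sat M (Conj (W e) f) s \<longleftrightarrow> univ_sat M k s A" if "carrier M \<noteq> {}" for M :: "'a gp_struct" and s
    using sat_All_block_QF[OF that vars] g(1)[symmetric] by (auto simp: W f univ_sat_def)
  ultimately show thesis by (intro that[of "Conj (W e) f"]) (auto simp: computable_Pi_def)
qed

lemma computable_Sigma1_exists:
  assumes "ce_qf A"
  obtains \<phi> where "computable_Sigma 1 k \<phi>"
    "\<forall>(M::'a gp_struct) s. carrier M \<noteq> {} \<longrightarrow>
      (sat M \<phi> s \<longleftrightarrow> (\<exists>s' a. extends M k s s' \<and> a \<in> A \<and> qf_sat M s' a))"
proof -
  obtain e l g and D :: "nat set"
    where W: "W e = (\<lambda>x. prod_encode (l x, prod_encode (0, qf_code (g x)))) ` D"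
      and l: "inj l" and g: "g ` D = A" "\<forall>x. \<forall>i\<in>qf_vars (g x). i < l x"
    using assms by (rule ce_qf_indices)
  define f where "f = (\<lambda>i. let x = inv_into UNIV l (fst (prod_decode i)) in Ex_block k (l x) (QF (g x)))"
  have f: "f (prod_encode (l x, j)) = Ex_block k (l x) (QF (g x))" for x j
    unfolding f_def using inv_into_f_f[OF l UNIV_I] by (simp add: Let_def)
  have vars: "qf_vars (g x) \<subseteq> {..<k + l x}" for x using g(2) by fastforce
  have "Sigma_index 1 k e (Disj (W e) f)"
  proof (rule Sigma_pos)
    fix i assume "i \<in> W e"
    then obtain x where "x \<in> D" "i = prod_encode (l x, prod_encode (0, qf_code (g x)))"
      unfolding W by blast
    with Pi_zero[OF vars[of x]] f
    show "\<exists>l m j \<psi>. i = prod_encode (l, prod_encode (m, j)) \<and> m < 1 \<and>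
      Pi_index m (k + l) j \<psi> \<and> f i = Ex_block k l \<psi>" by blast
  qed simp
  moreover have "sat M (Disj (W e) f) s \<longleftrightarrow> (\<exists>s' a. extends M k s s' \<and> a \<in> A \<and> qf_sat M s' a)"
    if "carrier M \<noteq> {}" for M :: "'a gp_struct" and s
    using sat_Ex_block_QF[OF that vars] g(1)[symmetric] by (auto simp: W f)
  ultimately show thesis by (intro that[of "Disj (W e) f"]) (auto simp: computable_Sigma_def)
qed

text \<open>The matrices can be read off the index set, and the block lengths forgotten, because
  \<open>univ_sat\<close> binds every variable from \<open>k\<close> on. Level 0 is included since
  the disjuncts of a \<open>\<Sigma>\<^sub>2\<close> formula may have quantifier-free
  matrices.\<close>

lemma Pi_index_le_1_imp_ce_qf:
  assumes "Pi_index m k e \<phi>" "m \<le> 1"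
  obtains A where "ce_qf A"
    "\<forall>(M::'a gp_struct) s. carrier M \<noteq> {} \<longrightarrow> (sat M \<phi> s \<longleftrightarrow> univ_sat M k s A)"
  using assms(1)
proof (cases rule: Pi_index.cases)
  case (Pi_zero a)
  have "sat M \<phi> s \<longleftrightarrow> univ_sat M k s {a}" if "carrier M \<noteq> {}" for M :: "'a gp_struct" and s
    using univ_sat_closed[OF that, of "{a}" k s] Pi_zero by auto
  with ce_qf_singleton show thesis by (intro that[of "{a}"]) auto
next
  case (Pi_pos f)
  let ?g = "\<lambda>i. qf_of (snd (prod_decode (snd (prod_decode i))))"
  have "computable (\<lambda>i. qf_code (?g i))"
    \<comment> \<open>Decoding followed by encoding is the trivial substitution.\<close>
    using comp_compose[OF comp_qf_subst[of Var] comp_snd[OF comp_snd[OF comp_id]]]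
    by (simp add: comp_intros)
  then have "ce_qf (?g ` W e)" by (rule ce_qfI[OF ce_W])
  moreover have "sat M \<phi> s \<longleftrightarrow> univ_sat M k s (?g ` W e)" if M: "carrier M \<noteq> {}" for M :: "'a gp_struct" and s
  proof -
    have "sat M (f i) s \<longleftrightarrow> univ_sat M k s {?g i}" if "i \<in> W e" for i
    proof -
      obtain l m' j \<psi> where *: "i = prod_encode (l, prod_encode (m', j))" "m' < m"
        "Sigma_index m' (k + l) j \<psi>" "f i = All_block k l \<psi>"
        using Pi_pos(3)[OF \<open>i \<in> W e\<close>] by blast
      with assms(2) have "m' = 0" by simp
      with * have "Sigma_index 0 (k + l) j \<psi>" by simp
      then obtain a where "\<psi> = QF a" "j = qf_code a" "qf_vars a \<subseteq> {..<k + l}"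
        by (cases rule: Sigma_index.cases) auto
      with * sat_All_block_QF[OF M] show ?thesis by simp
    qed
    then show ?thesis unfolding Pi_pos(1) by (auto simp: univ_sat_def)
  qed
  ultimately show thesis by (intro that[of "?g ` W e"]) auto
qed

section \<open>Isomorphisms and generating tuples\<close>

text \<open>Unlike \<open>struct_iso\<close> this names the map, so that its effect on tuples can be
  stated.\<close>

definition siso :: "('a \<Rightarrow> 'b) \<Rightarrow> 'a gp_struct \<Rightarrow> 'b gp_struct \<Rightarrow> bool" where
  "siso h M N \<longleftrightarrow> h \<in> iso M N \<and> h (one M) = one N \<and> (\<forall>x\<in>carrier M. h (invop M x) = invop N (h x))"

lemma tm_val_closed:
  "is_structure M \<Longrightarrow> (\<And>i. i \<in> tm_vars t \<Longrightarrow> s i \<in> carrier M) \<Longrightarrow> tm_val M s t \<in> carrier M"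
  by (induction t) (auto simp: is_structure_def)

lemma siso_tm_val:
  assumes "siso h M N" "is_structure M" "\<And>i. i \<in> tm_vars t \<Longrightarrow> s i \<in> carrier M"
  shows "h (tm_val M s t) = tm_val N (\<lambda>i. h (s i)) t"
  using assms(3)
proof (induction t)
  case (Mul t u)
  then show ?case using assms(1) tm_val_closed[OF assms(2), of t s] tm_val_closed[OF assms(2), of u s]
    by (auto simp: siso_def iso_def hom_def)
next
  case (Inv t)
  then show ?case using assms(1) tm_val_closed[OF assms(2), of t s] by (auto simp: siso_def)
qed (use assms(1) in \<open>auto simp: siso_def\<close>)

lemma siso_qf_sat:
  assumes "siso h M N" "is_structure M" "\<And>i. s i \<in> carrier M"
  shows "qf_sat N (\<lambda>i. h (s i)) a \<longleftrightarrow> qf_sat M s a"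
proof (induction a)
  case (Eq t u)
  have "inj_on h (carrier M)" using assms(1) by (auto simp: siso_def iso_def bij_betw_def)
  moreover have "tm_val M s t \<in> carrier M" "tm_val M s u \<in> carrier M"
    using assms by (auto intro: tm_val_closed)
  ultimately have "h (tm_val M s t) = h (tm_val M s u) \<longleftrightarrow> tm_val M s t = tm_val M s u"
    by (auto dest: inj_onD)
  then show ?case using assms by (simp add: siso_tm_val)
qed auto

lemma siso_sat:
  assumes "siso h M N" "is_structure M" "\<And>i. s i \<in> carrier M"
  shows "sat N \<phi> (\<lambda>i. h (s i)) \<longleftrightarrow> sat M \<phi> s"
  using assms(3)
proof (induction \<phi> arbitrary: s)
  case (QF a)
  then show ?case using siso_qf_sat[OF assms(1,2)] by simp
next
  have surj: "h ` carrier M = carrier N" using assms(1) by (auto simp: siso_def iso_def bij_betw_def)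
  have upd: "(\<lambda>i. h (s i))(j := h x) = (\<lambda>i. h ((s(j := x)) i))" for s j x by auto
  {
    case (Ex j \<phi>)
    have "sat N \<phi> ((\<lambda>i. h (s i))(j := h x)) \<longleftrightarrow> sat M \<phi> (s(j := x))" if "x \<in> carrier M" for x
      unfolding upd by (rule Ex.IH) (use Ex.prems that in auto)
    then show ?case by (simp add: surj[symmetric])
  next
    case (All j \<phi>)
    have "sat N \<phi> ((\<lambda>i. h (s i))(j := h x)) \<longleftrightarrow> sat M \<phi> (s(j := x))" if "x \<in> carrier M" for x
      unfolding upd by (rule All.IH) (use All.prems that in auto)
    then show ?case by (simp add: surj[symmetric])
  }
qed auto

lemma siso_inv_into:
  assumes h: "siso h M N" and M: "is_structure M"
  shows "siso (inv_into (carrier M) h) N M"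
proof -
  let ?g = "inv_into (carrier M) h"
  have b: "bij_betw h (carrier M) (carrier N)" using h by (simp add: siso_def iso_def)
  have g: "?g y \<in> carrier M" "h (?g y) = y" if "y \<in> carrier N" for y
    using b that by (auto simp: bij_betw_def inv_into_into f_inv_into_f)
  have inv: "?g (h x) = x" if "x \<in> carrier M" for x
    using b that by (auto simp: bij_betw_def)
  have bg: "bij_betw ?g (carrier N) (carrier M)" by (rule bij_betw_inv_into[OF b])
  have "?g (mult N x y) = mult M (?g x) (?g y)" if "x \<in> carrier N" "y \<in> carrier N" for x y
    using inv[of "mult M (?g x) (?g y)"] g[OF that(1)] g[OF that(2)] h M
    by (auto simp: siso_def iso_def hom_def is_structure_def)
  moreover have "?g (invop N x) = invop M (?g x)" if "x \<in> carrier N" for x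
    using inv[of "invop M (?g x)"] g[OF that] h M by (auto simp: siso_def is_structure_def)
  moreover have "?g (one N) = one M"
    using inv[of "one M"] h M by (auto simp: siso_def is_structure_def)
  ultimately show ?thesis using bg g(1) by (auto simp: siso_def iso_def hom_def)
qed

lemma siso_univ_sat:
  assumes h: "siso h M N" and M: "is_structure M" and s: "\<And>i. i < r \<Longrightarrow> s i \<in> carrier M"
    and sat: "univ_sat M r s A"
  shows "univ_sat N r (\<lambda>i. h (s i)) A"
  unfolding univ_sat_def
proof (intro allI impI ballI)
  fix s' a assume s': "extends N r (\<lambda>i. h (s i)) s'" and "a \<in> A"
  let ?g = "inv_into (carrier M) h"
  have b: "bij_betw h (carrier M) (carrier N)" using h by (simp add: siso_def iso_def)
  have N: "s' i \<in> carrier N" for i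
    using s' s b by (cases "i < r") (auto simp: extends_def bij_betw_def)
  let ?t = "\<lambda>i. ?g (s' i)"
  have t: "?t i \<in> carrier M" "h (?t i) = s' i" for i
    using b N[of i] by (auto simp: bij_betw_def inv_into_into f_inv_into_f)
  have "extends M r s ?t"
    using s' s t b by (auto simp: extends_def bij_betw_def)
  with sat \<open>a \<in> A\<close> have "qf_sat M ?t a" unfolding univ_sat_def by blast
  with siso_qf_sat[OF h M t(1)] t(2) show "qf_sat N s' a" by simp
qed

definition spans :: "'a gp_struct \<Rightarrow> nat \<Rightarrow> (nat \<Rightarrow> 'a) \<Rightarrow> bool" where
  "spans M r s \<longleftrightarrow> (\<forall>x\<in>carrier M. \<exists>t. tm_vars t \<subseteq> {..<r} \<and> x = tm_val M s t)"

definition same_equations :: "'a gp_struct \<Rightarrow> 'b gp_struct \<Rightarrow> nat \<Rightarrow> (nat \<Rightarrow> 'a) \<Rightarrow> (nat \<Rightarrow> 'b) \<Rightarrow> bool" where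
  "same_equations M N r s s' \<longleftrightarrow> (\<forall>t u. tm_vars t \<subseteq> {..<r} \<longrightarrow> tm_vars u \<subseteq> {..<r} \<longrightarrow>
    (tm_val M s t = tm_val M s u \<longleftrightarrow> tm_val N s' t = tm_val N s' u))"

text \<open>The value of a term at \<open>s\<close> is sent to its value at \<open>s'\<close>.
  Sharing equations makes this well defined and injective, spanning makes it total and onto, and it
  respects the operations because they are term constructors.\<close>

lemma spans_siso:
  assumes M: "is_structure M" and N: "is_structure N"
    and s: "\<And>i. i < r \<Longrightarrow> s i \<in> carrier M" and s': "\<And>i. i < r \<Longrightarrow> s' i \<in> carrier N"
    and "spans M r s" "spans N r s'" and eq: "same_equations M N r s s'"
  obtains h where "siso h M N" "\<And>i. i < r \<Longrightarrow> h (s i) = s' i"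
proof -
  obtain w where w: "\<And>x. x \<in> carrier M \<Longrightarrow> tm_vars (w x) \<subseteq> {..<r} \<and> x = tm_val M s (w x)"
    using \<open>spans M r s\<close> unfolding spans_def by metis
  define h where "h x = tm_val N s' (w x)" for x
  have val: "tm_val M s t \<in> carrier M" "tm_val N s' t \<in> carrier N" if "tm_vars t \<subseteq> {..<r}" for t
    using that s s' by (auto intro!: tm_val_closed M N)
  have h: "h (tm_val M s t) = tm_val N s' t" if "tm_vars t \<subseteq> {..<r}" for t
    using eq w[OF val(1)[OF that]] that unfolding same_equations_def h_def by metis
  have "inj_on h (carrier M)"
    unfolding inj_on_def h_def using eq w unfolding same_equations_def by metis
  moreover have "h ` carrier M = carrier N"
  proof
    show "h ` carrier M \<subseteq> carrier N" unfolding h_def using w val by auto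
    show "carrier N \<subseteq> h ` carrier M"
    proof
      fix y assume "y \<in> carrier N"
      then obtain t where t: "tm_vars t \<subseteq> {..<r}" "y = tm_val N s' t"
        using \<open>spans N r s'\<close> unfolding spans_def by blast
      with h val show "y \<in> h ` carrier M" by (metis image_eqI)
    qed
  qed
  moreover have "h (mult M x y) = mult N (h x) (h y)" if "x \<in> carrier M" "y \<in> carrier M" for x y
    using h[of "Mul (w x) (w y)"] h[of "w x"] h[of "w y"] w[OF that(1)] w[OF that(2)] by simp
  moreover have "h (invop M x) = invop N (h x)" if "x \<in> carrier M" for x
    using h[of "Inv (w x)"] h[of "w x"] w[OF that] by simp
  moreover have "h (one M) = one N" using h[of One] by simp
  ultimately have "siso h M N" by (auto simp: siso_def iso_def hom_def bij_betw_def)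
  moreover have "h (s i) = s' i" if "i < r" for i using h[of "Var i"] that by simp
  ultimately show thesis by (rule that)
qed

lemma siso_spans:
  assumes h: "siso h M N" and M: "is_structure M" and s: "\<And>i. i < r \<Longrightarrow> s i \<in> carrier M"
    and "spans M r s"
  shows "spans N r (\<lambda>i. h (s i))"
  unfolding spans_def
proof
  fix y assume "y \<in> carrier N"
  then obtain x where "x \<in> carrier M" "y = h x"
    using h by (auto simp: siso_def iso_def bij_betw_def)
  moreover from this \<open>spans M r s\<close> obtain t where "tm_vars t \<subseteq> {..<r}" "x = tm_val M s t"
    unfolding spans_def by auto
  ultimately have "tm_vars t \<subseteq> {..<r}" "y = h (tm_val M s t)" by auto
  with siso_tm_val[OF h M, of t s] s show "\<exists>t. tm_vars t \<subseteq> {..<r} \<and> y = tm_val N (\<lambda>i. h (s i)) t"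
    by (auto simp: subset_iff)
qed

section \<open>Words in a tuple and its atomic type\<close>

lemma computable_restricted_Var: "computable (\<lambda>i. tm_code (if i < r then Var i else One))"
proof -
  have "computable (\<lambda>i. if i < r then tm_code (Var i) else tm_code One)"
    unfolding tm_code.simps by (intro comp_intros)
  then show ?thesis by (simp add: if_distrib[of tm_code])
qed

text \<open>Variables from \<open>r\<close> on are overwritten by \<open>One\<close>, so every
  number yields a term in the first \<open>r\<close> variables and all such terms occur.\<close>

definition word :: "nat \<Rightarrow> nat \<Rightarrow> tm" where
  "word r n = tm_subst (\<lambda>i. if i < r then Var i else One) (tm_of n)"

lemma computable_word: "computable f \<Longrightarrow> computable (\<lambda>n. tm_code (word r (f n)))"
  unfolding word_def by (rule comp_compose[OF comp_tm_subst[OF computable_restricted_Var]])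

lemma range_word: "range (word r) = {t. tm_vars t \<subseteq> {..<r}}"
proof (intro equalityI subsetI)
  fix t assume "t \<in> {t. tm_vars t \<subseteq> {..<r}}"
  then have "tm_subst (\<lambda>i. if i < r then Var i else One) t = tm_subst Var t"
    by (intro tm_subst_cong) auto
  then have "t = word r (tm_code t)" by (simp add: word_def)
  then show "t \<in> range (word r)" by (rule range_eqI)
qed (auto simp: word_def tm_vars_subst split: if_splits)

text \<open>Literals suffice: by \<open>spans_siso\<close> they determine the isomorphism type of a
  structure together with a tuple spanning it.\<close>

definition atomic_type :: "'a gp_struct \<Rightarrow> nat \<Rightarrow> (nat \<Rightarrow> 'a) \<Rightarrow> qf set" where
  "atomic_type M r s =
    {if tm_val M s t = tm_val M s u then Eq t u else QNot (Eq t u) | t u.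
      tm_vars t \<subseteq> {..<r} \<and> tm_vars u \<subseteq> {..<r}}"

lemma univ_sat_atomic_type:
  assumes "carrier N \<noteq> {}"
  shows "univ_sat N r s' (atomic_type M r s) \<longleftrightarrow> same_equations M N r s s'"
proof -
  have "univ_sat N r s' (atomic_type M r s) \<longleftrightarrow> (\<forall>a\<in>atomic_type M r s. qf_sat N s' a)"
    using assms by (rule univ_sat_closed) (auto simp: atomic_type_def split: if_splits)
  also have "\<dots> \<longleftrightarrow> same_equations M N r s s'"
  proof
    assume l: "\<forall>a\<in>atomic_type M r s. qf_sat N s' a"
    show "same_equations M N r s s'" unfolding same_equations_def
    proof (intro allI impI)
      fix t u assume "tm_vars t \<subseteq> {..<r}" "tm_vars u \<subseteq> {..<r}"
      then have "(if tm_val M s t = tm_val M s u then Eq t u else QNot (Eq t u)) \<in> atomic_type M r s"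
        unfolding atomic_type_def by blast
      with l have "qf_sat N s' (if tm_val M s t = tm_val M s u then Eq t u else QNot (Eq t u))"
        by (rule bspec)
      then show "tm_val M s t = tm_val M s u \<longleftrightarrow> tm_val N s' t = tm_val N s' u"
        by (simp split: if_splits)
    qed
  next
    assume r: "same_equations M N r s s'"
    show "\<forall>a\<in>atomic_type M r s. qf_sat N s' a"
    proof
      fix a assume "a \<in> atomic_type M r s"
      then obtain t u where a: "a = (if tm_val M s t = tm_val M s u then Eq t u else QNot (Eq t u))"
        and "tm_vars t \<subseteq> {..<r}" "tm_vars u \<subseteq> {..<r}" unfolding atomic_type_def by blast
      with r have "tm_val M s t = tm_val M s u \<longleftrightarrow> tm_val N s' t = tm_val N s' u"
        unfolding same_equations_def by blast
      then show "qf_sat N s' a" unfolding a by simp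
    qed
  qed
  finally show ?thesis .
qed

text \<open>Naming each entry of the tuple by its constant turns an equation between words into an
  atomic sentence, which the atomic diagram decides. The naming is a finite table.\<close>

lemma ce_qf_atomic_type:
  assumes "computable_structure M"
  shows "ce_qf (atomic_type M r s)"
proof -
  have D: "computable_set (qf_code ` atomic_diagram M)"
    using assms by (simp add: computable_structure_def)
  \<comment> \<open>In the atomic diagram \<open>Var k\<close> names the number \<open>k\<close>, so
    \<open>Var (s i)\<close> names the entry \<open>s i\<close>.\<close>
  let ?\<tau> = "\<lambda>i. if i < r then Var (s i) else One"
  let ?t = "\<lambda>n. word r (fst (prod_decode n))" and ?u = "\<lambda>n. word r (snd (prod_decode n))"
  let ?named = "\<lambda>n. Eq (tm_subst ?\<tau> (?t n)) (tm_subst ?\<tau> (?u n))"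
  let ?f = "\<lambda>n. if qf_code (?named n) \<in> qf_code ` atomic_diagram M
    then Eq (?t n) (?u n) else QNot (Eq (?t n) (?u n))"
  have \<tau>: "computable (\<lambda>i. tm_code (?\<tau> i))"
    using comp_finite_modification[where f = "\<lambda>i. tm_code (Var (s i))" and n = r,
        OF comp_const[of "tm_code One"]]
    by (simp add: if_distrib[of tm_code])
  have sub: "computable (\<lambda>n. tm_code (tm_subst ?\<tau> (word r (f n))))" if "computable f" for f
    using comp_compose[OF comp_tm_subst[OF \<tau>] computable_word[OF that]] by simp
  have "computable (\<lambda>n. if qf_code (?named n) \<in> qf_code ` atomic_diagram M
      then qf_code (Eq (?t n) (?u n)) else qf_code (QNot (Eq (?t n) (?u n))))"
    unfolding qf_code.simps by (intro comp_if_mem[OF D] comp_intros computable_word sub)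
  also have "(\<lambda>n. if qf_code (?named n) \<in> qf_code ` atomic_diagram M
      then qf_code (Eq (?t n) (?u n)) else qf_code (QNot (Eq (?t n) (?u n)))) = (\<lambda>n. qf_code (?f n))"
    by (simp only: if_distrib[of qf_code])
  finally have "ce_qf (range ?f)" by (rule ce_qf_range)
  also have "range ?f = atomic_type M r s"
  proof -
    have "inj qf_code" by (rule inj_on_inverseI[of _ qf_of]) simp
    then have "qf_code (?named n) \<in> qf_code ` atomic_diagram M \<longleftrightarrow> ?named n \<in> atomic_diagram M" for n
      by (simp only: inj_image_mem_iff)
    moreover have "?named n \<in> atomic_diagram M \<longleftrightarrow> tm_val M s (?t n) = tm_val M s (?u n)" for n
    proof -
      have "tm_val M (\<lambda>i. i) (tm_subst ?\<tau> (word r m)) = tm_val M s (word r m)" for m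
      proof -
        have "tm_vars (word r m) \<subseteq> {..<r}" using range_word[of r] by blast
        then show ?thesis unfolding tm_val_subst by (intro tm_val_cong) auto
      qed
      then show ?thesis by (auto simp: atomic_diagram_def)
    qed
    ultimately have f: "?f = (\<lambda>n. if tm_val M s (?t n) = tm_val M s (?u n)
        then Eq (?t n) (?u n) else QNot (Eq (?t n) (?u n)))" by (simp only:)
    show ?thesis
    proof (intro equalityI subsetI)
      fix a assume "a \<in> range ?f"
      then show "a \<in> atomic_type M r s"
        unfolding f atomic_type_def using range_word[of r] by blast
    next
      fix a assume "a \<in> atomic_type M r s"
      then obtain t u where a: "a = (if tm_val M s t = tm_val M s u then Eq t u else QNot (Eq t u))"
        and "tm_vars t \<subseteq> {..<r}" "tm_vars u \<subseteq> {..<r}" unfolding atomic_type_def by blast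
      then obtain m n where "t = word r m" "u = word r n"
        using range_word[of r] by blast
      then have "a = (\<lambda>n. if tm_val M s (?t n) = tm_val M s (?u n)
          then Eq (?t n) (?u n) else QNot (Eq (?t n) (?u n))) (prod_encode (m, n))"
        unfolding a by simp
      then show "a \<in> range ?f" unfolding f by (rule range_eqI)
    qed
  qed
  finally show ?thesis .
qed

section \<open>From orbits to Scott sentences\<close>

text \<open>In a model of the sentence \<open>\<psi>\<close> gives a tuple with the equations of
  \<open>s\<close>, and \<open>\<chi>\<close> makes it span, so \<open>spans_siso\<close> applies.
  In \<open>M\<close> the part \<open>\<chi>\<close> holds because a tuple satisfying
  \<open>A\<close> is an automorphic copy of \<open>s\<close> and hence spans.\<close>

lemma orbit_imp_d_Sigma2:
  fixes M :: "nat gp_struct"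
  assumes M: "is_structure M" "computable_structure M" and spans: "spans M r s"
    and A: "ce_qf A"
    and orbit: "\<And>s'. univ_sat M r s' A \<longleftrightarrow> (\<exists>h. siso h M M \<and> (\<forall>i<r. s' i = h (s i)))"
  shows "\<exists>\<phi>. computable_d_Sigma 2 0 \<phi> \<and> scott_sentence M \<phi>"
proof -
  have UNIV: "carrier M = UNIV" using M(2) by (simp add: computable_structure_def)
  have ne: "carrier N \<noteq> {}" if "is_structure N" for N :: "nat gp_struct"
    using that by (auto simp: is_structure_def)
  obtain C where C: "ce_qf C" "\<forall>(N::nat gp_struct) k t. univ_sat N k t C \<longleftrightarrow>
      univ_sat N k t A \<and> univ_sat N k t (atomic_type M r s)"
    using A ce_qf_atomic_type[OF M(2)] by (rule ce_qf_conj)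
  obtain \<alpha> where "computable_Pi 1 r \<alpha>"
    and sat_\<alpha>: "\<forall>(N::nat gp_struct) t. carrier N \<noteq> {} \<longrightarrow> (sat N \<alpha> t \<longleftrightarrow> univ_sat N r t C)"
    using C(1) by (rule computable_Pi1_exists)
  then obtain j where j: "Pi_index 1 r j \<alpha>" unfolding computable_Pi_def by blast
  obtain e where e: "W e = {prod_encode (r, prod_encode (1, j))}"
    using ce_insert[OF ce_empty] by (rule ce_imp_W)
  define \<psi> where "\<psi> = Disj (W e) (\<lambda>i. Ex_block 0 r \<alpha>)"
  have \<psi>: "Sigma_index 2 0 e \<psi>" unfolding \<psi>_def
    by (rule Sigma_pos) (use j e in auto)
  have sat_\<psi>: "sat N \<psi> t \<longleftrightarrow>
      (\<exists>t'. (\<forall>i\<ge>r. t' i = t i) \<and> (\<forall>i<r. t' i \<in> carrier N) \<and> univ_sat N r t' C)"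
    if "is_structure N" for N :: "nat gp_struct" and t
    using sat_\<alpha> ne[OF that] by (auto simp: \<psi>_def e sat_Ex_block)
  obtain A' where A': "ce_qf A'" "A' \<noteq> {}"
    "\<forall>(N::nat gp_struct) k t. univ_sat N k t A' \<longleftrightarrow> univ_sat N k t A"
    using A by (rule ce_qf_nonempty)
  \<comment> \<open>Position \<open>r\<close> is reserved for the element to be written as a word,
    so the bound variables of \<open>A\<close> move up by one.\<close>
  let ?shift = "\<lambda>i. if i < r then Var i else Var (Suc i)"
  let ?B1 = "QNot ` qf_subst ?shift ` A'" and ?B2 = "range (\<lambda>n. Eq (Var r) (word r n))"
  \<comment> \<open>Read existentially, \<open>B\<close> says that \<open>A\<close> fails or that
    the element at \<open>r\<close> is a word in the tuple. Pairing in place of a union requires a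
    partner for each disjunct: any word on one side and, as \<open>A'\<close> is nonempty, any
    matrix on the other.\<close>
  define B where "B = {QOr a b | a b. a \<in> ?B1 \<and> b \<in> ?B2}"
  have "computable (\<lambda>i. tm_code (?shift i))"
  proof -
    have "computable (\<lambda>i. if i < r then tm_code (Var i) else tm_code (Var (Suc i)))"
      unfolding tm_code.simps by (intro comp_intros)
    then show ?thesis by (simp only: if_distrib[of tm_code])
  qed
  then have "ce_qf ?B1" by (intro ce_qf_QNot ce_qf_subst A'(1))
  moreover have "ce_qf ?B2"
    by (rule ce_qf_range) (unfold qf_code.simps, intro comp_intros computable_word)
  ultimately have "ce_qf B" unfolding B_def by (rule ce_qf_QOr)
  then obtain \<beta> where "computable_Sigma 1 (Suc r) \<beta>"
    and sat_\<beta>: "\<forall>(N::nat gp_struct) t. carrier N \<noteq> {} \<longrightarrow>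
      (sat N \<beta> t \<longleftrightarrow> (\<exists>t' b. extends N (Suc r) t t' \<and> b \<in> B \<and> qf_sat N t' b))"
    by (rule computable_Sigma1_exists)
  then obtain j' where j': "Sigma_index 1 (Suc r) j' \<beta>" unfolding computable_Sigma_def by blast
  have sat_\<beta>: "sat N \<beta> t \<longleftrightarrow> \<not> univ_sat N r t A \<or> (\<exists>w. tm_vars w \<subseteq> {..<r} \<and> t r = tm_val N t w)"
    (is "_ \<longleftrightarrow> ?rhs") if N: "is_structure N" and t: "t r \<in> carrier N"
    for N :: "nat gp_struct" and t
  proof -
    have "sat N \<beta> t \<longleftrightarrow> (\<exists>t' b. extends N (Suc r) t t' \<and> b \<in> B \<and> qf_sat N t' b)"
      using sat_\<beta> ne[OF N] by blast
    also have "\<dots> \<longleftrightarrow> ?rhs"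
    proof
      assume "\<exists>t' b. extends N (Suc r) t t' \<and> b \<in> B \<and> qf_sat N t' b"
      then obtain t' b where t': "extends N (Suc r) t t'" and "b \<in> B" "qf_sat N t' b" by blast
      moreover from this obtain a n where "a \<in> A'"
        and "b = QOr (QNot (qf_subst ?shift a)) (Eq (Var r) (word r n))"
        unfolding B_def by blast
      ultimately have sat: "\<not> qf_sat N t' (qf_subst ?shift a) \<or> t' r = tm_val N t' (word r n)"
        by simp
      from sat show ?rhs
      proof
        assume "\<not> qf_sat N t' (qf_subst ?shift a)"
        then have "\<not> qf_sat N (\<lambda>i. tm_val N t' (?shift i)) a" unfolding qf_sat_subst .
        moreover have "extends N r t (\<lambda>i. tm_val N t' (?shift i))"
          using t' by (auto simp: extends_def)
        ultimately have "\<not> univ_sat N r t A'" using \<open>a \<in> A'\<close> unfolding univ_sat_def by blast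
        then show ?rhs using A'(3) by blast
      next
        assume "t' r = tm_val N t' (word r n)"
        moreover have w: "tm_vars (word r n) \<subseteq> {..<r}" using range_word[of r] by blast
        moreover have "tm_val N t' (word r n) = tm_val N t (word r n)"
          by (rule tm_val_cong) (use w t' in \<open>auto simp: extends_def\<close>)
        ultimately show ?rhs using t' by (auto simp: extends_def)
      qed
    next
      assume ?rhs
      then show "\<exists>t' b. extends N (Suc r) t t' \<and> b \<in> B \<and> qf_sat N t' b"
      proof
        assume "\<not> univ_sat N r t A"
        then have "\<not> univ_sat N r t A'" using A'(3) by blast
        then obtain t' a where t': "extends N r t t'" and "a \<in> A'" "\<not> qf_sat N t' a"
          unfolding univ_sat_def by blast
        \<comment> \<open>The values of \<open>t'\<close> from position \<open>r\<close> on move up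
          one place, as \<open>?shift\<close> expects, while position \<open>r\<close> keeps the
          value of \<open>t\<close>.\<close>
        let ?t = "\<lambda>i. if i < Suc r then t i else t' (i - 1)"
        have "(\<lambda>i. tm_val N ?t (?shift i)) = t'" using t' by (auto simp: extends_def)
        then have "\<not> qf_sat N ?t (qf_subst ?shift a)" unfolding qf_sat_subst using \<open>\<not> qf_sat N t' a\<close> by simp
        moreover have "extends N (Suc r) t ?t" using t' by (auto simp: extends_def)
        moreover have "QOr (QNot (qf_subst ?shift a)) (Eq (Var r) (word r 0)) \<in> B"
          using \<open>a \<in> A'\<close> unfolding B_def by blast
        ultimately show ?thesis by (metis qf_sat.simps(2,4))
      next
        assume "\<exists>w. tm_vars w \<subseteq> {..<r} \<and> t r = tm_val N t w"
        then obtain w where w: "tm_vars w \<subseteq> {..<r}" "t r = tm_val N t w" by blast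
        then have "w \<in> range (word r)" by (simp add: range_word)
        obtain a where "a \<in> A'" using A'(2) by blast
        obtain t' where t': "extends N (Suc r) t t'" using ne[OF N] by (rule extends_exists)
        have "tm_val N t' w = tm_val N t w"
          by (rule tm_val_cong) (use w t' in \<open>auto simp: extends_def\<close>)
        with w t' have "qf_sat N t' (Eq (Var r) w)" by (simp add: extends_def)
        moreover have "QOr (QNot (qf_subst ?shift a)) (Eq (Var r) w) \<in> B"
          using \<open>a \<in> A'\<close> \<open>w \<in> range (word r)\<close> unfolding B_def by blast
        ultimately show ?thesis using t' by (metis qf_sat.simps(4))
      qed
    qed
    finally show ?thesis .
  qed
  obtain e' where e': "W e' = {prod_encode (Suc r, prod_encode (1, j'))}"
    using ce_insert[OF ce_empty] by (rule ce_imp_W)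
  define \<chi> where "\<chi> = Conj (W e') (\<lambda>i. All_block 0 (Suc r) \<beta>)"
  have \<chi>: "Pi_index 2 0 e' \<chi>" unfolding \<chi>_def
    by (rule Pi_pos) (use j' e' in auto)
  have sat_\<chi>: "sat N \<chi> t \<longleftrightarrow> (\<forall>t'. (\<forall>i>r. t' i = t i) \<longrightarrow> (\<forall>i\<le>r. t' i \<in> carrier N) \<longrightarrow>
      \<not> univ_sat N r t' A \<or> (\<exists>w. tm_vars w \<subseteq> {..<r} \<and> t' r = tm_val N t' w))"
    if "is_structure N" for N :: "nat gp_struct" and t
  proof -
    have "sat N \<chi> t \<longleftrightarrow> (\<forall>t'. (\<forall>i>r. t' i = t i) \<longrightarrow> (\<forall>i\<le>r. t' i \<in> carrier N) \<longrightarrow> sat N \<beta> t')"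
      by (auto simp: \<chi>_def e' sat_All_block Suc_le_eq less_Suc_eq_le)
    then show ?thesis using sat_\<beta>[OF that] by auto
  qed
  have sat_M: "sat M (And \<psi> \<chi>) t" for t
  proof -
    have "univ_sat M r s A" unfolding orbit
      by (rule exI[of _ id]) (simp add: siso_def iso_def hom_def)
    moreover have "univ_sat M r s (atomic_type M r s)"
      unfolding univ_sat_atomic_type[OF ne[OF M(1)]] by (simp add: same_equations_def)
    ultimately have "univ_sat M r s C" using C(2) by blast
    then have "univ_sat M r (\<lambda>i. if i < r then s i else t i) C"
      by (subst univ_sat_cong[where t = s]) auto
    then have "sat M \<psi> t" unfolding sat_\<psi>[OF M(1)]
      by (intro exI[of _ "\<lambda>i. if i < r then s i else t i"]) (auto simp: UNIV)
    moreover have "sat M \<chi> t" unfolding sat_\<chi>[OF M(1)]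
    proof (intro allI impI disjCI)
      fix t' assume "\<not> (\<exists>w. tm_vars w \<subseteq> {..<r} \<and> t' r = tm_val M t' w)"
      show "\<not> univ_sat M r t' A"
      proof
        assume "univ_sat M r t' A"
        then obtain h where h: "siso h M M" "\<And>i. i < r \<Longrightarrow> t' i = h (s i)" unfolding orbit by blast
        have "spans M r (\<lambda>i. h (s i))"
          by (rule siso_spans[OF h(1) M(1) _ spans]) (simp add: UNIV)
        then obtain w where w: "tm_vars w \<subseteq> {..<r}" "t' r = tm_val M (\<lambda>i. h (s i)) w"
          unfolding spans_def UNIV by blast
        moreover have "tm_val M (\<lambda>i. h (s i)) w = tm_val M t' w"
          by (rule tm_val_cong) (use w h in auto)
        ultimately show False using \<open>\<not> (\<exists>w. _ w)\<close> by auto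
      qed
    qed
    ultimately show ?thesis by (simp add: And_def)
  qed
  have "scott_sentence M (And \<psi> \<chi>)" unfolding scott_sentence_def
  proof (intro conjI allI impI)
    show "sentence (And \<psi> \<chi>)"
      using index_free_vars(1)[OF \<psi>] index_free_vars(2)[OF \<chi>] by (simp add: sentence_def And_def)
    fix N :: "nat gp_struct" assume N: "is_structure N"
    show "models N (And \<psi> \<chi>) \<longleftrightarrow> struct_iso M N"
    proof
      assume "struct_iso M N"
      then obtain h where "siso h M N" unfolding struct_iso_def siso_def by blast
      from siso_inv_into[OF this M(1)] obtain g where g: "siso g N M" ..
      show "models N (And \<psi> \<chi>)" unfolding models_def
      proof (intro allI impI)
        fix t :: "nat \<Rightarrow> nat" assume "range t \<subseteq> carrier N"
        with siso_sat[OF g N, of t "And \<psi> \<chi>"] sat_M show "sat N (And \<psi> \<chi>) t" by auto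
      qed
    next
      assume "models N (And \<psi> \<chi>)"
      moreover define t where "t = (\<lambda>i::nat. one N)"
      moreover have "one N \<in> carrier N" using N by (simp add: is_structure_def)
      ultimately have "sat N (And \<psi> \<chi>) t" unfolding models_def by auto
      then have "sat N \<psi> t" and \<chi>: "sat N \<chi> t" by (auto simp: And_def)
      then obtain t' where t': "\<And>i. r \<le> i \<Longrightarrow> t' i = t i" "\<And>i. i < r \<Longrightarrow> t' i \<in> carrier N"
        "univ_sat N r t' C" unfolding sat_\<psi>[OF N] by blast
      with C(2) have "univ_sat N r t' A" and "univ_sat N r t' (atomic_type M r s)" by blast+
      then have eq: "same_equations M N r s t'" using univ_sat_atomic_type[OF ne[OF N]] by blast
      have "spans N r t'" unfolding spans_def
      proof
        fix y assume "y \<in> carrier N"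
        \<comment> \<open>Position \<open>r\<close> lies outside the tuple, so placing
          \<open>y\<close> there does not affect the truth of \<open>A\<close>.\<close>
        let ?t = "t'(r := y)"
        have "univ_sat N r ?t A" using \<open>univ_sat N r t' A\<close> univ_sat_cong[of r ?t t'] by simp
        moreover have "(\<forall>i>r. ?t i = t i)" "(\<forall>i\<le>r. ?t i \<in> carrier N)"
          using t' \<open>y \<in> carrier N\<close> by auto
        ultimately obtain w where w: "tm_vars w \<subseteq> {..<r}" "y = tm_val N ?t w"
          using \<chi> unfolding sat_\<chi>[OF N] by (metis fun_upd_same)
        moreover have "tm_val N ?t w = tm_val N t' w"
          by (rule tm_val_cong) (use w in auto)
        ultimately show "\<exists>w. tm_vars w \<subseteq> {..<r} \<and> y = tm_val N t' w" by auto
      qed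
      from spans_siso[OF M(1) N _ t'(2) spans this eq] obtain h where "siso h M N"
        by (auto simp: UNIV)
      then show "struct_iso M N" unfolding struct_iso_def siso_def by blast
    qed
  qed
  moreover have "computable_d_Sigma 2 0 (And \<psi> \<chi>)"
    using \<psi> \<chi> unfolding computable_d_Sigma_def computable_Sigma_def computable_Pi_def by blast
  ultimately show ?thesis by blast
qed

lemma d_Sigma2_imp_Pi3:
  assumes "computable_d_Sigma 2 0 \<phi>" "scott_sentence M \<phi>"
  shows "\<exists>\<phi>. computable_Pi 3 0 \<phi> \<and> scott_sentence M \<phi>"
proof -
  obtain \<psi> \<chi> d e where \<psi>: "Sigma_index 2 0 d \<psi>" and \<chi>: "Pi_index 2 0 e \<chi>" and \<phi>: "\<phi> = And \<psi> \<chi>"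
    using assms(1) unfolding computable_d_Sigma_def computable_Sigma_def computable_Pi_def by blast
  from \<chi> obtain f where f: "\<chi> = Conj (W e) f" "\<And>i. i \<in> W e \<Longrightarrow>
      \<exists>l m j \<psi>. i = prod_encode (l, prod_encode (m, j)) \<and> m < 2 \<and>
        Sigma_index m (0 + l) j \<psi> \<and> f i = All_block 0 l \<psi>"
    by (cases rule: Pi_index.cases) auto
  \<comment> \<open>The whole of \<open>\<psi>\<close> becomes one conjunct, under an empty block.
    The triples in \<open>W e\<close> have levels below 2, so the new index clashes with none of
    them and \<open>g\<close> may assign \<open>\<psi>\<close> to it.\<close>
  let ?c = "prod_encode (0, prod_encode (2, d))"
  have "?c \<notin> W e" using f(2) by fastforce
  obtain e' where e': "W e' = insert ?c (W e)"
    using ce_insert[OF ce_W] by (rule ce_imp_W)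
  define g where "g = (\<lambda>i. if i = ?c then \<psi> else f i)"
  have "Pi_index 3 0 e' (Conj (W e') g)"
  proof (rule Pi_pos)
    fix i assume "i \<in> W e'"
    then consider "i = ?c" | "i \<in> W e" "i \<noteq> ?c" using \<open>?c \<notin> W e\<close> unfolding e' by blast
    then show "\<exists>l m j \<psi>. i = prod_encode (l, prod_encode (m, j)) \<and> m < 3 \<and>
        Sigma_index m (0 + l) j \<psi> \<and> g i = All_block 0 l \<psi>"
    proof cases
      case 1
      with \<psi> show ?thesis
        by (intro exI[of _ 0] exI[of _ 2] exI[of _ d] exI[of _ \<psi>]) (simp add: g_def All_block_def)
    next
      case 2
      from f(2)[OF 2(1)] obtain l m j \<psi>' where "i = prod_encode (l, prod_encode (m, j))" "m < 2"
        "Sigma_index m (0 + l) j \<psi>'" "f i = All_block 0 l \<psi>'" by blast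
      with 2 show ?thesis
        by (intro exI[of _ l] exI[of _ m] exI[of _ j] exI[of _ \<psi>']) (simp add: g_def)
    qed
  qed simp
  moreover from this have "scott_sentence M (Conj (W e') g)"
  proof -
    have "sat N (Conj (W e') g) = sat N \<phi>" for N :: "nat gp_struct"
      using \<open>?c \<notin> W e\<close> by (auto simp: e' g_def \<phi> f(1) And_def fun_eq_iff)
    moreover have "sentence (Conj (W e') g)"
      using index_free_vars(2)[OF \<open>Pi_index 3 0 e' (Conj (W e') g)\<close>] by (simp add: sentence_def)
    ultimately show ?thesis using assms(2) by (simp add: scott_sentence_def models_def)
  qed
  ultimately show ?thesis unfolding computable_Pi_def by blast
qed

section \<open>Omitting an orbit\<close>

text \<open>The Rasiowa-Sikorski argument: the requirements are listed and met one at a time by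
  finite good sets. The union of the chain need not be good itself, but each of its finite subsets
  lies in one stage.\<close>

lemma generic_set_exists:
  fixes good :: "'p set \<Rightarrow> bool"
  assumes "countable \<Z>" and "good {}"
    and mono: "\<And>P Q. good Q \<Longrightarrow> P \<subseteq> Q \<Longrightarrow> good P"
    and dense: "\<And>P Z. finite P \<Longrightarrow> good P \<Longrightarrow> Z \<in> \<Z> \<Longrightarrow> \<exists>q\<in>Z. good (insert q P)"
  obtains T where "\<forall>F. finite F \<longrightarrow> F \<subseteq> T \<longrightarrow> good F" "\<forall>Z\<in>\<Z>. T \<inter> Z \<noteq> {}"
proof (cases "\<Z> = {}")
  case True
  with \<open>good {}\<close> show thesis by (intro that[of "{}"]) auto
next
  case False
  define Z where "Z = from_nat_into \<Z>"
  have Z: "range Z = \<Z>" unfolding Z_def using False assms(1) by (rule range_from_nat_into)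
  have "\<exists>p. \<forall>n. (finite (p n) \<and> good (p n)) \<and> p n \<subseteq> p (Suc n) \<and> p (Suc n) \<inter> Z n \<noteq> {}"
  proof (rule dependent_nat_choice)
    show "\<exists>P. finite P \<and> good P" using \<open>good {}\<close> by blast
    fix P n assume P: "finite P \<and> good P"
    have "Z n \<in> \<Z>" using Z by blast
    with dense P obtain q where "q \<in> Z n" "good (insert q P)" by blast
    with P show "\<exists>Q. (finite Q \<and> good Q) \<and> P \<subseteq> Q \<and> Q \<inter> Z n \<noteq> {}"
      by (intro exI[of _ "insert q P"]) auto
  qed
  then obtain p where p: "\<And>n. good (p n)" "\<And>n. p n \<subseteq> p (Suc n)" "\<And>n. p (Suc n) \<inter> Z n \<noteq> {}"
    by blast
  have chain: "p m \<subseteq> p n" if "m \<le> n" for m n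
    using p(2) that by (rule lift_Suc_mono_le)
  have "good F" if F: "finite F" "F \<subseteq> \<Union>(range p)" for F
  proof -
    from F have "\<exists>n. F \<subseteq> p n"
    proof (induction F)
      case (insert x F)
      then obtain m n where "F \<subseteq> p m" "x \<in> p n" by blast
      moreover have "p m \<subseteq> p (max m n)" "p n \<subseteq> p (max m n)"
        using chain by auto
      ultimately have "insert x F \<subseteq> p (max m n)" by blast
      then show ?case ..
    qed simp
    with mono p(1) show "good F" by blast
  qed
  moreover have "\<Union>(range p) \<inter> Y \<noteq> {}" if "Y \<in> \<Z>" for Y
  proof -
    from that Z obtain n where "Y = Z n" by blast
    with p(3)[of n] show ?thesis by blast
  qed
  ultimately show thesis by (intro that[of "\<Union>(range p)"]) auto
qed

section \<open>Finite conditions in the Henkin constants\<close>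

type_synonym piece = "nat list \<times> qf set"

text \<open>
  A piece \<open>(\<sigma>, A)\<close> asserts the universal closure of \<open>A\<close> with its first variables
  replaced by the constants listed in \<open>\<sigma>\<close>; the function \<open>c\<close> interprets the constants.
\<close>

definition realizes :: "'a gp_struct \<Rightarrow> (nat \<Rightarrow> 'a) \<Rightarrow> piece set \<Rightarrow> bool" where
  "realizes M c P \<longleftrightarrow> (\<forall>(\<sigma>, A)\<in>P. univ_sat M (length \<sigma>) (\<lambda>i. c (\<sigma> ! i)) A)"

lemma realizes_insert:
  "realizes M c (insert (\<sigma>, A) P) \<longleftrightarrow> univ_sat M (length \<sigma>) (\<lambda>i. c (\<sigma> ! i)) A \<and> realizes M c P"
  by (simp add: realizes_def)

lemma realizes_cong:
  assumes "\<forall>q\<in>P. set (fst q) \<subseteq> {..<n}" "\<And>i. i < n \<Longrightarrow> c i = d i"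
  shows "realizes M c P \<longleftrightarrow> realizes M d P"
proof -
  have "univ_sat M (length \<sigma>) (\<lambda>i. c (\<sigma> ! i)) A \<longleftrightarrow> univ_sat M (length \<sigma>) (\<lambda>i. d (\<sigma> ! i)) A"
    if "(\<sigma>, A) \<in> P" for \<sigma> A
  proof (rule univ_sat_cong)
    fix i assume "i < length \<sigma>"
    then have "\<sigma> ! i \<in> set \<sigma>" by simp
    with bspec[OF assms(1) that] have "\<sigma> ! i < n" by auto
    then show "c (\<sigma> ! i) = d (\<sigma> ! i)" by (rule assms(2))
  qed
  then show ?thesis unfolding realizes_def by blast
qed

text \<open>From \<open>n\<close> on the constants may be reinterpreted without disturbing a
  realization of \<open>P\<close>, by \<open>realizes_cong\<close>.\<close>

lemma fresh_constant:
  fixes P :: "piece set" and V :: "nat set"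
  assumes "finite P" "finite V"
  obtains n where "\<forall>q\<in>P. set (fst q) \<subseteq> {..<n}" "V \<subseteq> {..<n}"
proof -
  have "finite (V \<union> (\<Union>q\<in>P. set (fst q)))" using assms by simp
  from finite_nat_bounded[OF this]
  obtain n where n: "V \<union> (\<Union>q\<in>P. set (fst q)) \<subseteq> {..<n}" ..
  show thesis by (rule that[of n]) (use n in blast)+
qed

text \<open>Listing the constants in order lets \<open>Var i\<close> in \<open>a\<close> stand for
  the constant \<open>i\<close> itself.\<close>

definition atom :: "nat \<Rightarrow> qf \<Rightarrow> piece" where
  "atom n a = ([0..<n], {a})"

lemma univ_sat_atom:
  assumes "carrier M \<noteq> {}" "qf_vars a \<subseteq> {..<n}"
  shows "univ_sat M (length [0..<n]) (\<lambda>i. c ([0..<n] ! i)) {a} \<longleftrightarrow> qf_sat M c a"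
proof -
  have "univ_sat M (length [0..<n]) (\<lambda>i. c ([0..<n] ! i)) {a} \<longleftrightarrow> univ_sat M n c {a}"
    using univ_sat_cong[of n "\<lambda>i. c ([0..<n] ! i)" c] by simp
  then show ?thesis using univ_sat_closed[OF assms(1), of "{a}" n c] assms(2) by simp
qed

lemma finite_tm_vars: "finite (tm_vars t)"
  by (induction t) auto

lemma finite_qf_vars: "finite (qf_vars a)"
  by (induction a) (auto intro: finite_tm_vars)

text \<open>The model consists of the constants modulo the equations in \<open>T\<close>. Every
  element has a name, so a universal piece could only fail at constants; that failure would be a
  quantifier-free statement in \<open>T\<close> incompatible in \<open>M\<close> with the
  piece.\<close>

lemma term_model:
  fixes M :: "'a gp_struct"
  assumes M: "is_structure M"
    and fin: "\<And>F. finite F \<Longrightarrow> F \<subseteq> T \<Longrightarrow> \<exists>c. range c \<subseteq> carrier M \<and> realizes M c F"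
    and decided: "\<And>a. \<exists>n. qf_vars a \<subseteq> {..<n} \<and> (atom n a \<in> T \<or> atom n (QNot a) \<in> T)"
    and named: "\<And>t. \<exists>k n. k < n \<and> tm_vars t \<subseteq> {..<n} \<and> atom n (Eq (Var k) t) \<in> T"
  obtains N :: "nat gp_struct" and v :: "nat \<Rightarrow> nat"
  where "is_structure N" "carrier N = range v"
    "\<forall>(\<sigma>, A)\<in>T. univ_sat N (length \<sigma>) (\<lambda>i. v (\<sigma> ! i)) A"
proof -
  have ne: "carrier M \<noteq> {}" using M by (auto simp: is_structure_def)
  define Th where "Th a \<longleftrightarrow> (\<exists>n. qf_vars a \<subseteq> {..<n} \<and> atom n a \<in> T)" for a
  \<comment> \<open>The extra pieces \<open>Q\<close> allow a quantifier-free statement to be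
    confronted with a universal piece at the end.\<close>
  have consistent: "\<exists>c. range c \<subseteq> carrier M \<and> (\<forall>a\<in>F. qf_sat M c a) \<and> realizes M c Q"
    if "finite F" "\<forall>a\<in>F. Th a" "finite Q" "Q \<subseteq> T" for F Q
  proof -
    from that(2) obtain n where n: "\<And>a. a \<in> F \<Longrightarrow> qf_vars a \<subseteq> {..<n a} \<and> atom (n a) a \<in> T"
      unfolding Th_def by metis
    have "finite ((\<lambda>a. atom (n a) a) ` F \<union> Q)" "(\<lambda>a. atom (n a) a) ` F \<union> Q \<subseteq> T"
      using that n by auto
    from fin[OF this] obtain c where c: "range c \<subseteq> carrier M" "realizes M c ((\<lambda>a. atom (n a) a) ` F \<union> Q)"
      by blast
    have "qf_sat M c a" if "a \<in> F" for a
    proof -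
      have "([0..<n a], {a}) \<in> (\<lambda>a. atom (n a) a) ` F \<union> Q"
        using that unfolding atom_def by blast
      with c(2) have "univ_sat M (length [0..<n a]) (\<lambda>i. c ([0..<n a] ! i)) {a}"
        unfolding realizes_def by blast
      with univ_sat_atom[OF ne] n[OF that] show ?thesis by blast
    qed
    moreover have "realizes M c Q" using c(2) unfolding realizes_def by blast
    ultimately show ?thesis using c(1) by blast
  qed
  have Th_or: "Th a \<or> Th (QNot a)" for a
    using decided[of a] unfolding Th_def by auto
  \<comment> \<open>\<open>Th\<close> is complete and finitely satisfiable in \<open>M\<close>,
    hence closed under consequences that hold there; this supplies the laws of equality and of the
    connectives.\<close>
  have entail: "Th b"
    if "finite F" "\<And>a. a \<in> F \<Longrightarrow> Th a" "\<And>c. \<forall>a\<in>F. qf_sat M c a \<Longrightarrow> qf_sat M c b" for F b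
  proof (rule ccontr)
    assume "\<not> Th b"
    with Th_or have "Th (QNot b)" by blast
    with consistent[of "insert (QNot b) F" "{}"] that(1,2)
    obtain c where "\<forall>a\<in>insert (QNot b) F. qf_sat M c a" by auto
    with that(3)[of c] show False by simp
  qed
  have Th_QNot: "Th (QNot a) \<longleftrightarrow> \<not> Th a" for a
    using Th_or[of a] consistent[of "{a, QNot a}" "{}"] by auto
  have entail2: "Th d" if "Th a" "Th b" "\<And>c. qf_sat M c a \<Longrightarrow> qf_sat M c b \<Longrightarrow> qf_sat M c d"
    for a b d
    by (rule entail[of "{a, b}"]) (use that in auto)
  have entail1: "Th d" if "Th a" "\<And>c. qf_sat M c a \<Longrightarrow> qf_sat M c d" for a d
    by (rule entail2[OF that(1) that(1)]) (rule that(2))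
  have Th_QAnd: "Th (QAnd a b) \<longleftrightarrow> Th a \<and> Th b" for a b
  proof
    assume ab: "Th (QAnd a b)"
    have "Th a" by (rule entail1[OF ab]) simp
    moreover have "Th b" by (rule entail1[OF ab]) simp
    ultimately show "Th a \<and> Th b" ..
  next
    assume "Th a \<and> Th b"
    then have "Th a" "Th b" by auto
    then show "Th (QAnd a b)" by (rule entail2) simp
  qed
  have Th_QOr: "Th (QOr a b) \<longleftrightarrow> Th a \<or> Th b" for a b
  proof
    assume ab: "Th (QOr a b)"
    show "Th a \<or> Th b"
    proof (rule disjCI)
      assume "\<not> Th b"
      then have "Th (QNot b)" by (simp add: Th_QNot)
      with ab show "Th a" by (rule entail2) simp
    qed
  next
    assume "Th a \<or> Th b"
    then show "Th (QOr a b)"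
    proof
      assume "Th a" then show ?thesis by (rule entail1) simp
    next
      assume "Th b" then show ?thesis by (rule entail1) simp
    qed
  qed
  \<comment> \<open>The least constant equal to \<open>t\<close> represents its class, so the
    carrier is a set of numbers rather than a quotient.\<close>
  define u where "u t = (LEAST k. Th (Eq (Var k) t))" for t
  have u: "Th (Eq (Var (u t)) t)" for t
    unfolding u_def
  proof (rule LeastI_ex)
    obtain k n where "k < n" "tm_vars t \<subseteq> {..<n}" "atom n (Eq (Var k) t) \<in> T" using named by blast
    then show "\<exists>k. Th (Eq (Var k) t)" unfolding Th_def by (intro exI[of _ k] exI[of _ n]) auto
  qed
  have u_eq: "u t = u t' \<longleftrightarrow> Th (Eq t t')" for t t'
  proof
    assume "u t = u t'"
    with u[of t'] have "Th (Eq (Var (u t)) t')" by simp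
    with u[of t] show "Th (Eq t t')" by (rule entail2) simp
  next
    assume t: "Th (Eq t t')"
    have "Th (Eq (Var k) t) \<longleftrightarrow> Th (Eq (Var k) t')" for k
    proof
      assume "Th (Eq (Var k) t)"
      with t show "Th (Eq (Var k) t')" by (rule entail2) simp
    next
      assume "Th (Eq (Var k) t')"
      with t show "Th (Eq (Var k) t)" by (rule entail2) simp
    qed
    then show "u t = u t'" unfolding u_def by simp
  qed
  define v where "v i = u (Var i)" for i
  have v_u: "v (u t) = u t" for t
    using u u_eq unfolding v_def by blast
  define N where "N = \<lparr>carrier = range v, mult = \<lambda>i j. u (Mul (Var i) (Var j)), one = u One,
    invop = \<lambda>i. u (Inv (Var i))\<rparr>"
  have u_range: "u t \<in> range v" for t using v_u[of t] by (metis rangeI)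
  have "is_structure N" using u_range by (simp add: is_structure_def N_def)
  have val: "tm_val N (\<lambda>i. v (s i)) t = u (tm_subst (\<lambda>i. Var (s i)) t)" for s t
  proof (induction t)
    case (Inv t)
    let ?t = "tm_subst (\<lambda>i. Var (s i)) t"
    have "u (Inv (Var (u ?t))) = u (Inv ?t)"
      unfolding u_eq by (rule entail1[OF u[of ?t]]) simp
    with Inv show ?case by (simp add: N_def)
  next
    case (Mul t t')
    let ?t = "tm_subst (\<lambda>i. Var (s i)) t" and ?t' = "tm_subst (\<lambda>i. Var (s i)) t'"
    have "u (Mul (Var (u ?t)) (Var (u ?t'))) = u (Mul ?t ?t')"
      unfolding u_eq by (rule entail2[OF u[of ?t] u[of ?t']]) simp
    with Mul show ?case by (simp add: N_def)
  qed (simp_all add: v_def N_def)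
  have sat: "qf_sat N (\<lambda>i. v (s i)) a \<longleftrightarrow> Th (qf_subst (\<lambda>i. Var (s i)) a)" for s a
    by (induction a) (simp_all add: val u_eq Th_QNot Th_QAnd Th_QOr)
  have "univ_sat N (length \<sigma>) (\<lambda>i. v (\<sigma> ! i)) A" if q: "(\<sigma>, A) \<in> T" for \<sigma> A
    unfolding univ_sat_def
  proof (intro allI impI ballI)
    fix s' a assume s': "extends N (length \<sigma>) (\<lambda>i. v (\<sigma> ! i)) s'" and "a \<in> A"
    \<comment> \<open>Since every element has a name, the bound variables too can be instantiated by
      constants.\<close>
    then have "\<forall>i. \<exists>k. length \<sigma> \<le> i \<longrightarrow> s' i = v k"
      by (auto simp: extends_def N_def image_iff)
    then obtain k where k: "\<And>i. length \<sigma> \<le> i \<Longrightarrow> s' i = v (k i)" by metis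
    define s where "s i = (if i < length \<sigma> then \<sigma> ! i else k i)" for i
    have s: "s' = (\<lambda>i. v (s i))" using s' k by (auto simp: s_def extends_def)
    show "qf_sat N s' a"
    proof (rule ccontr)
      assume "\<not> qf_sat N s' a"
      then have "Th (QNot (qf_subst (\<lambda>i. Var (s i)) a))" unfolding s sat Th_QNot .
      with consistent[of "{QNot (qf_subst (\<lambda>i. Var (s i)) a)}" "{(\<sigma>, A)}"] q
      obtain c where c: "range c \<subseteq> carrier M" "\<not> qf_sat M c (qf_subst (\<lambda>i. Var (s i)) a)"
        "realizes M c {(\<sigma>, A)}" by auto
      have "extends M (length \<sigma>) (\<lambda>i. c (\<sigma> ! i)) (\<lambda>i. c (s i))"
        using c(1) by (auto simp: extends_def s_def)
      with c(3) \<open>a \<in> A\<close> have "qf_sat M (\<lambda>i. c (s i)) a"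
        unfolding realizes_def univ_sat_def by auto
      with c(2) show False by (simp add: qf_sat_subst)
    qed
  qed
  with \<open>is_structure N\<close> show thesis by (intro that[of N v]) (auto simp: N_def)
qed


section \<open>Normal form of computable infinitary formulas of level three\<close>

text \<open>The pair \<open>(l, A)\<close> stands for a disjunct of a
  \<open>\<Sigma>\<^sub>2\<close> formula: \<open>l\<close> existential quantifiers in front of the
  universal closure of \<open>A\<close>.\<close>

definition ex_univ_sat :: "'a gp_struct \<Rightarrow> nat \<Rightarrow> (nat \<Rightarrow> 'a) \<Rightarrow> nat \<times> qf set \<Rightarrow> bool" where
  "ex_univ_sat M k s q \<longleftrightarrow> (\<exists>s'. (\<forall>i. i < k \<or> k + fst q \<le> i \<longrightarrow> s' i = s i) \<and>
    (\<forall>i\<in>{k..<k + fst q}. s' i \<in> carrier M) \<and> univ_sat M (k + fst q) s' (snd q))"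

text \<open>Each disjunct keeps its effectivity, since it may enter a condition. The set
  \<open>B\<close> of disjuncts carries none: it only serves to state requirements.\<close>

lemma Sigma2_normal_form:
  assumes "Sigma_index m k e \<psi>" "m \<le> 2"
  shows "\<exists>B. (\<forall>q\<in>B. ce_qf (snd q)) \<and>
    (\<forall>(M::'a gp_struct) s. carrier M \<noteq> {} \<longrightarrow> (sat M \<psi> s \<longleftrightarrow> (\<exists>q\<in>B. ex_univ_sat M k s q)))"
  using assms(1)
proof (cases rule: Sigma_index.cases)
  case (Sigma_zero a)
  have "ex_univ_sat M k s (0, {a}) \<longleftrightarrow> qf_sat M s a" if "carrier M \<noteq> {}" for M :: "'a gp_struct" and s
  proof -
    have "ex_univ_sat M k s (0, {a}) \<longleftrightarrow> univ_sat M k s {a}"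
    proof
      assume "ex_univ_sat M k s (0, {a})"
      then obtain s' where "\<forall>i. i < k \<or> k \<le> i \<longrightarrow> s' i = s i" "univ_sat M k s' {a}"
        unfolding ex_univ_sat_def by auto
      then show "univ_sat M k s {a}" using univ_sat_cong[of k s s'] by simp
    next
      assume "univ_sat M k s {a}"
      then show "ex_univ_sat M k s (0, {a})"
        unfolding ex_univ_sat_def by (intro exI[of _ s]) simp
    qed
    then show ?thesis using univ_sat_closed[OF that, of "{a}" k s] Sigma_zero by simp
  qed
  with Sigma_zero show ?thesis
    by (intro exI[of _ "{(0, {a})}"]) (simp add: ce_qf_singleton)
next
  case (Sigma_pos f)
  have "\<forall>i\<in>W e. \<exists>q. ce_qf (snd q) \<and> (\<forall>(M::'a gp_struct) s. carrier M \<noteq> {} \<longrightarrow>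
      (sat M (f i) s \<longleftrightarrow> ex_univ_sat M k s q))"
  proof
    fix i assume i: "i \<in> W e"
    obtain l m' j \<chi> where *: "m' < m" "Pi_index m' (k + l) j \<chi>" "f i = Ex_block k l \<chi>"
      using Sigma_pos(3)[OF i] by blast
    with assms(2) have "m' \<le> 1" by simp
    with *(2) obtain A where "ce_qf A"
      "\<forall>(M::'a gp_struct) s. carrier M \<noteq> {} \<longrightarrow> (sat M \<chi> s \<longleftrightarrow> univ_sat M (k + l) s A)"
      by (rule Pi_index_le_1_imp_ce_qf)
    then show "\<exists>q. ce_qf (snd q) \<and> (\<forall>(M::'a gp_struct) s. carrier M \<noteq> {} \<longrightarrow>
      (sat M (f i) s \<longleftrightarrow> ex_univ_sat M k s q))"
      by (intro exI[of _ "(l, A)"]) (simp add: *(3) sat_Ex_block ex_univ_sat_def)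
  qed
  from bchoice[OF this] obtain q where q: "\<forall>i\<in>W e. ce_qf (snd (q i)) \<and> (\<forall>(M::'a gp_struct) s. carrier M \<noteq> {} \<longrightarrow>
      (sat M (f i) s \<longleftrightarrow> ex_univ_sat M k s (q i)))" ..
  then show ?thesis
    by (intro exI[of _ "q ` W e"]) (auto simp: Sigma_pos(1))
qed

lemma Pi3_normal_form:
  assumes "Pi_index 3 0 e \<phi>"
  obtains I :: "nat set" and B L where "\<forall>i\<in>I. \<forall>q\<in>B i. ce_qf (snd q)"
    "\<forall>(M::'a gp_struct) s. carrier M \<noteq> {} \<longrightarrow> (sat M \<phi> s \<longleftrightarrow>
      (\<forall>i\<in>I. \<forall>s'. (\<forall>j\<ge>L i. s' j = s j) \<longrightarrow> (\<forall>j<L i. s' j \<in> carrier M) \<longrightarrow>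
        (\<exists>q\<in>B i. ex_univ_sat M (L i) s' q)))"
  using assms
proof (cases rule: Pi_index.cases)
  case (Pi_pos f)
  have "\<forall>i\<in>W e. \<exists>p. (\<forall>q\<in>snd p. ce_qf (snd q)) \<and> (\<forall>(M::'a gp_struct) s. carrier M \<noteq> {} \<longrightarrow>
      (sat M (f i) s \<longleftrightarrow> (\<forall>s'. (\<forall>j\<ge>fst p. s' j = s j) \<longrightarrow> (\<forall>j<fst p. s' j \<in> carrier M) \<longrightarrow>
        (\<exists>q\<in>snd p. ex_univ_sat M (fst p) s' q))))"
  proof
    fix i assume i: "i \<in> W e"
    obtain l m j \<psi> where *: "m < 3" "Sigma_index m (0 + l) j \<psi>" "f i = All_block 0 l \<psi>"
      using Pi_pos(3)[OF i] by blast
    then have "m \<le> 2" by simp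
    from Sigma2_normal_form[OF *(2) this, where 'a = 'a] obtain B where "\<forall>q\<in>B. ce_qf (snd q)"
      "\<forall>(M::'a gp_struct) s. carrier M \<noteq> {} \<longrightarrow> (sat M \<psi> s \<longleftrightarrow> (\<exists>q\<in>B. ex_univ_sat M (0 + l) s q))"
      by blast
    then show "\<exists>p. (\<forall>q\<in>snd p. ce_qf (snd q)) \<and> (\<forall>(M::'a gp_struct) s. carrier M \<noteq> {} \<longrightarrow>
      (sat M (f i) s \<longleftrightarrow> (\<forall>s'. (\<forall>j\<ge>fst p. s' j = s j) \<longrightarrow> (\<forall>j<fst p. s' j \<in> carrier M) \<longrightarrow>
        (\<exists>q\<in>snd p. ex_univ_sat M (fst p) s' q))))"
      by (intro exI[of _ "(l, B)"]) (simp add: *(3) sat_All_block Ball_def)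
  qed
  from bchoice[OF this] obtain p where p: "\<forall>i\<in>W e. (\<forall>q\<in>snd (p i). ce_qf (snd q)) \<and>
      (\<forall>(M::'a gp_struct) s. carrier M \<noteq> {} \<longrightarrow>
      (sat M (f i) s \<longleftrightarrow> (\<forall>s'. (\<forall>j\<ge>fst (p i). s' j = s j) \<longrightarrow> (\<forall>j<fst (p i). s' j \<in> carrier M) \<longrightarrow>
        (\<exists>q\<in>snd (p i). ex_univ_sat M (fst (p i)) s' q))))" ..
  then show thesis
    by (intro that[of "W e" "\<lambda>i. snd (p i)" "\<lambda>i. fst (p i)"]) (simp_all add: Pi_pos(1))
qed simp

section \<open>From Scott sentences to orbits\<close>

text \<open>If no finite condition forced a tuple of constants to be a copy of \<open>s\<close>,
  every such tuple could be spoiled at any stage. The generic model would satisfy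
  \<open>\<phi>\<close> and be isomorphic to \<open>M\<close>, although the names of the image of
  \<open>s\<close> had been spoiled.\<close>

lemma Pi3_imp_supported:
  fixes M :: "nat gp_struct"
  assumes M: "is_structure M" "computable_structure M" and spans: "spans M r s"
    and \<phi>: "computable_Pi 3 0 \<phi>" "scott_sentence M \<phi>"
  shows "\<exists>P \<sigma>. finite P \<and> (\<forall>q\<in>P. ce_qf (snd q)) \<and> length \<sigma> = r \<and> (\<exists>c. realizes M c P) \<and>
    (\<forall>c. realizes M c P \<longrightarrow> (\<exists>h. siso h M M \<and> (\<forall>i<r. h (s i) = c (\<sigma> ! i))))"
proof -
  have UNIV: "carrier M = UNIV" using M(2) by (simp add: computable_structure_def)
  then have ne: "carrier M \<noteq> {}" by simp
  define good where "good P \<longleftrightarrow> (\<forall>q\<in>P. ce_qf (snd q)) \<and> (\<exists>c. realizes M c P)" for P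
  define conjugate where
    "conjugate c \<sigma> \<longleftrightarrow> (\<exists>h. siso h M M \<and> (\<forall>i<r. h (s i) = c (\<sigma> ! i)))" for c and \<sigma> :: "nat list"
  have "\<exists>P \<sigma>. finite P \<and> good P \<and> length \<sigma> = r \<and> (\<forall>c. realizes M c P \<longrightarrow> conjugate c \<sigma>)"
  proof (rule ccontr)
    assume contra: "\<not> ?thesis"
    from \<phi>(1) obtain e where e: "Pi_index 3 0 e \<phi>" unfolding computable_Pi_def by blast
    from e obtain I :: "nat set" and B L
      where B: "\<forall>i\<in>I. \<forall>q\<in>B i. ce_qf (snd q)"
        and sat_\<phi>: "\<forall>(M::nat gp_struct) s. carrier M \<noteq> {} \<longrightarrow> (sat M \<phi> s \<longleftrightarrow>
        (\<forall>i\<in>I. \<forall>s'. (\<forall>j\<ge>L i. s' j = s j) \<longrightarrow> (\<forall>j<L i. s' j \<in> carrier M) \<longrightarrow>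
          (\<exists>q\<in>B i. ex_univ_sat M (L i) s' q)))"
      by (rule Pi3_normal_form)
    have scott: "sentence \<phi>" "\<And>N::nat gp_struct. is_structure N \<Longrightarrow> models N \<phi> \<longleftrightarrow> struct_iso M N"
      using \<phi>(2) by (auto simp: scott_sentence_def)
    have "siso id M M" by (simp add: siso_def iso_def hom_def)
    then have "struct_iso M M" unfolding struct_iso_def siso_def by (intro bexI[of _ id]) auto
    with scott(2)[OF M(1)] have "sat M \<phi> t" for t by (simp add: models_def UNIV)
    then have all: "\<forall>i\<in>I. \<forall>s'. (\<forall>j\<ge>L i. s' j = t j) \<longrightarrow> (\<forall>j<L i. s' j \<in> carrier M) \<longrightarrow>
        (\<exists>q\<in>B i. ex_univ_sat M (L i) s' q)" for t
      using sat_\<phi>[rule_format, OF ne, of t] by simp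
    have M_\<phi>: "\<exists>q\<in>B i. ex_univ_sat M (L i) t q" if "i \<in> I" for i t
      by (rule all[rule_format]) (use that in \<open>simp_all add: UNIV\<close>)

    define ZD where "ZD a = {q. \<exists>n. qf_vars a \<subseteq> {..<n} \<and> (q = atom n a \<or> q = atom n (QNot a))}" for a
    define ZN where "ZN t = {q. \<exists>k n. k < n \<and> tm_vars t \<subseteq> {..<n} \<and> q = atom n (Eq (Var k) t)}" for t
    \<comment> \<open>A requirement takes conjunct \<open>fst p\<close> at the constants
      \<open>snd p\<close>; the constants \<open>\<tau>\<close> are witnesses for the existential
      block of the chosen disjunct.\<close>
    define ZE where "ZE p = {q. \<exists>\<tau>. fst q = snd p @ \<tau> \<and> (length \<tau>, snd q) \<in> B (fst p)}"
      for p :: "nat \<times> nat list"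
    let ?out = "range (\<lambda>n. QNot (Eq (Var r) (word r n)))"
    \<comment> \<open>A tuple is spoiled either by violating a literal of the type of
      \<open>s\<close> or by a constant \<open>y\<close> that \<open>?out\<close> keeps outside its
      span. Both are pieces, that is, universal assertions.\<close>
    define ZO where "ZO \<sigma> = {q. \<exists>a\<in>atomic_type M r s. q = (\<sigma>, {QNot a})} \<union> {q. \<exists>y. q = (\<sigma> @ [y], ?out)}"
      for \<sigma> :: "nat list"
    define \<Z> where "\<Z> = range (\<lambda>n. ZD (qf_of n)) \<union> range (\<lambda>n. ZN (tm_of n)) \<union>
      ZE ` {p. fst p \<in> I \<and> length (snd p) = L (fst p)} \<union> ZO ` {\<sigma>. length \<sigma> = r}"
    have "countable \<Z>" unfolding \<Z>_def by (intro countable_Un countable_image countableI_type)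
    moreover have "good {}" by (simp add: good_def realizes_def)
    moreover have "good P" if "good Q" "P \<subseteq> Q" for P Q
      using that unfolding good_def realizes_def by (meson subsetD)
    moreover have "\<exists>q\<in>Z. good (insert q P)" if P: "finite P" "good P" and "Z \<in> \<Z>" for P Z
    proof -
      from P(2) obtain c where c: "realizes M c P" and ceP: "\<forall>q\<in>P. ce_qf (snd q)"
        unfolding good_def by blast
      have goodI: "good (insert (\<sigma>, A) P)"
        if "ce_qf A" "realizes M d P" "univ_sat M (length \<sigma>) (\<lambda>i. d (\<sigma> ! i)) A" for \<sigma> A d
        using that ceP unfolding good_def by (auto simp: realizes_insert)
      from \<open>Z \<in> \<Z>\<close> consider (D) a where "Z = ZD a" | (N) t where "Z = ZN t"
        | (E) i \<sigma> where "Z = ZE (i, \<sigma>)" "i \<in> I" "length \<sigma> = L i" | (O) \<sigma> where "Z = ZO \<sigma>" "length \<sigma> = r"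
        unfolding \<Z>_def by auto
      then show ?thesis
      proof cases
        case D
        obtain n where n: "qf_vars a \<subseteq> {..<n}"
          using finite_nat_bounded[OF finite_qf_vars[of a]] ..
        define b where "b = (if qf_sat M c a then a else QNot a)"
        have "good (insert (atom n b) P)" unfolding atom_def
        proof (rule goodI[OF ce_qf_singleton c])
          show "univ_sat M (length [0..<n]) (\<lambda>i. c ([0..<n] ! i)) {b}"
            by (subst univ_sat_atom[OF ne]) (use n in \<open>auto simp: b_def\<close>)
        qed
        moreover have "atom n b \<in> Z" unfolding D ZD_def b_def using n by (intro CollectI exI[of _ n]) simp
        ultimately show ?thesis by blast
      next
        case N
        obtain k where k: "\<forall>q\<in>P. set (fst q) \<subseteq> {..<k}" "tm_vars t \<subseteq> {..<k}"
          using P(1) finite_tm_vars[of t] by (rule fresh_constant)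
        \<comment> \<open>\<open>k\<close> lies beyond the constants of \<open>P\<close> and the
          variables of \<open>t\<close>, so giving it a new value disturbs neither.\<close>
        define d where "d = c(k := tm_val M c t)"
        have "realizes M d P" using realizes_cong[OF k(1), of c d] c by (simp add: d_def)
        have vars: "tm_vars t \<subseteq> {..<Suc k}" using k(2) by auto
        have "tm_val M d t = tm_val M c t"
          by (rule tm_val_cong) (use k(2) in \<open>auto simp: d_def\<close>)
        then have "qf_sat M d (Eq (Var k) t)" by (simp add: d_def)
        then have "univ_sat M (length [0..<Suc k]) (\<lambda>i. d ([0..<Suc k] ! i)) {Eq (Var k) t}"
          by (subst univ_sat_atom[OF ne]) (use vars in auto)
        with ce_qf_singleton \<open>realizes M d P\<close> have "good (insert (atom (Suc k) (Eq (Var k) t)) P)"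
          unfolding atom_def by (rule goodI)
        moreover have "atom (Suc k) (Eq (Var k) t) \<in> Z" unfolding N ZN_def using vars by blast
        ultimately show ?thesis by blast
      next
        case E
        obtain k where k: "\<forall>q\<in>P. set (fst q) \<subseteq> {..<k}" "set \<sigma> \<subseteq> {..<k}"
          using P(1) finite_set[of \<sigma>] by (rule fresh_constant)
        from M_\<phi>[OF E(2)] obtain q where q: "q \<in> B i" "ex_univ_sat M (L i) (\<lambda>j. c (\<sigma> ! j)) q" by blast
        obtain l A where lA: "q = (l, A)" by fastforce
        from q(2) obtain s' where s': "\<And>j. j < L i \<Longrightarrow> s' j = c (\<sigma> ! j)" "univ_sat M (L i + l) s' A"
          unfolding ex_univ_sat_def lA by auto
        \<comment> \<open>The existential witnesses occupy positions \<open>L i\<close> onward in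
          \<open>s'\<close>; they become the values of the fresh constants from \<open>k\<close>
          on.\<close>
        define d where "d j = (if j < k then c j else s' (L i + (j - k)))" for j
        have "realizes M d P" using realizes_cong[OF k(1), of c d] c by (simp add: d_def)
        let ?\<tau> = "[k..<k + l]"
        have "univ_sat M (length (\<sigma> @ ?\<tau>)) (\<lambda>j. d ((\<sigma> @ ?\<tau>) ! j)) A \<longleftrightarrow> univ_sat M (length (\<sigma> @ ?\<tau>)) s' A"
        proof (rule univ_sat_cong)
          fix j assume j: "j < length (\<sigma> @ ?\<tau>)"
          show "d ((\<sigma> @ ?\<tau>) ! j) = s' j"
          proof (cases "j < L i")
            case True
            then have "\<sigma> ! j \<in> set \<sigma>" using E(3) by simp
            then have "\<sigma> ! j < k" using k(2) by auto
            with True s'(1) E(3) show ?thesis by (simp add: nth_append d_def)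
          next
            case False
            define m where "m = j - L i"
            with False j E(3) have "j = L i + m" "m < l" by auto
            then show ?thesis using E(3) by (simp add: nth_append d_def)
          qed
        qed
        then have "univ_sat M (length (\<sigma> @ ?\<tau>)) (\<lambda>j. d ((\<sigma> @ ?\<tau>) ! j)) A" using s'(2) E(3) by simp
        moreover have "ce_qf A" using B E(2) q(1) lA by fastforce
        ultimately have "good (insert (\<sigma> @ ?\<tau>, A) P)" using \<open>realizes M d P\<close> by (intro goodI)
        moreover have "(\<sigma> @ ?\<tau>, A) \<in> Z" using q(1) lA unfolding E ZE_def by auto
        ultimately show ?thesis by blast
      next
        case O
        \<comment> \<open>The condition does not force \<open>\<sigma>\<close> to be a copy of
          \<open>s\<close>. How this realization fails to make it one decides which piece is
          added.\<close>
        from contra P O(2) obtain c where c: "realizes M c P" "\<not> conjugate c \<sigma>" by blast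
        let ?c = "\<lambda>i. c (\<sigma> ! i)"
        show ?thesis
        proof (cases "same_equations M M r s ?c")
          case False
          then have "\<not> univ_sat M r ?c (atomic_type M r s)" using univ_sat_atomic_type[OF ne] by blast
          moreover have vars: "qf_vars a \<subseteq> {..<r}" if "a \<in> atomic_type M r s" for a
            using that by (auto simp: atomic_type_def split: if_splits)
          ultimately obtain a where a: "a \<in> atomic_type M r s" "\<not> qf_sat M ?c a"
            using univ_sat_closed[OF ne, of "atomic_type M r s" r ?c] by blast
          have "univ_sat M r ?c {QNot a}"
            using univ_sat_closed[OF ne, of "{QNot a}" r ?c] vars[OF a(1)] a(2) by simp
          then have "good (insert (\<sigma>, {QNot a}) P)"
            using O(2) by (intro goodI[OF ce_qf_singleton c(1)]) simp
          moreover have "(\<sigma>, {QNot a}) \<in> Z" unfolding O ZO_def using a(1) by blast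
          ultimately show ?thesis by blast
        next
          case True
          \<comment> \<open>With equal atomic types, spanning would yield an automorphism taking
            \<open>s\<close> to the tuple.\<close>
          have "\<not> spans M r ?c"
          proof
            assume "spans M r ?c"
            with M(1) spans True obtain h where "siso h M M" "\<And>i. i < r \<Longrightarrow> h (s i) = ?c i"
              using spans_siso[of M M r s ?c] UNIV by auto
            then have "conjugate c \<sigma>" unfolding conjugate_def by (intro exI[of _ h]) simp
            with c(2) show False ..
          qed
          then obtain y where y: "\<And>t. tm_vars t \<subseteq> {..<r} \<Longrightarrow> y \<noteq> tm_val M ?c t"
            unfolding spans_def by blast
          obtain k where k: "\<forall>q\<in>P. set (fst q) \<subseteq> {..<k}" "set \<sigma> \<subseteq> {..<k}"
            using P(1) finite_set[of \<sigma>] by (rule fresh_constant)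
          define d where "d = c(k := y)"
          have "realizes M d P" using realizes_cong[OF k(1), of c d] c by (simp add: d_def)
          let ?d = "\<lambda>j. d ((\<sigma> @ [k]) ! j)"
          have vars: "tm_vars (word r n) \<subseteq> {..<r}" for n using range_word[of r] by blast
          have d: "?d i = ?c i" if "i < r" for i
          proof -
            have "\<sigma> ! i \<in> set \<sigma>" using O(2) that by simp
            then have "\<sigma> ! i \<noteq> k" using k(2) by auto
            then show ?thesis using that O(2) by (simp add: nth_append d_def)
          qed
          have "univ_sat M (Suc r) ?d ?out \<longleftrightarrow> (\<forall>a\<in>?out. qf_sat M ?d a)"
            by (rule univ_sat_closed[OF ne]) (use vars in fastforce)
          moreover have "qf_sat M ?d (QNot (Eq (Var r) (word r n)))" for n
          proof -
            have "tm_val M ?d (word r n) = tm_val M ?c (word r n)"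
              by (rule tm_val_cong) (use vars[of n] d in auto)
            then show ?thesis using y[OF vars[of n]] O(2) by (simp add: nth_append d_def)
          qed
          ultimately have "univ_sat M (length (\<sigma> @ [k])) ?d ?out" using O(2) by simp
          moreover have "ce_qf ?out"
            by (rule ce_qf_range) (unfold qf_code.simps, intro comp_intros computable_word)
          ultimately have "good (insert (\<sigma> @ [k], ?out) P)" using \<open>realizes M d P\<close> by (intro goodI)
          moreover have "(\<sigma> @ [k], ?out) \<in> Z" unfolding O ZO_def by blast
          ultimately show ?thesis by blast
        qed
      qed
    qed
    ultimately obtain T where fin: "\<forall>F. finite F \<longrightarrow> F \<subseteq> T \<longrightarrow> good F"
      and meets: "\<forall>Z\<in>\<Z>. T \<inter> Z \<noteq> {}"
      by (rule generic_set_exists)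

    have "\<exists>c. range c \<subseteq> carrier M \<and> realizes M c F" if "finite F" "F \<subseteq> T" for F
      using fin that by (simp add: good_def UNIV)
    moreover have "\<exists>n. qf_vars a \<subseteq> {..<n} \<and> (atom n a \<in> T \<or> atom n (QNot a) \<in> T)" for a
    proof -
      have "ZD (qf_of (qf_code a)) \<in> \<Z>" unfolding \<Z>_def by blast
      from bspec[OF meets this] show ?thesis unfolding ZD_def by auto
    qed
    moreover have "\<exists>k n. k < n \<and> tm_vars t \<subseteq> {..<n} \<and> atom n (Eq (Var k) t) \<in> T" for t
    proof -
      have "ZN (tm_of (tm_code t)) \<in> \<Z>" unfolding \<Z>_def by blast
      from bspec[OF meets this] show ?thesis unfolding ZN_def by auto
    qed
    ultimately obtain N :: "nat gp_struct" and v where N: "is_structure N" "carrier N = range v"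
      and T: "\<forall>(\<sigma>, A)\<in>T. univ_sat N (length \<sigma>) (\<lambda>i. v (\<sigma> ! i)) A"
      by (rule term_model[OF M(1)])
    have pieces: "univ_sat N (length \<sigma>) (\<lambda>i. v (\<sigma> ! i)) A" if "(\<sigma>, A) \<in> T" for \<sigma> A
      using T that by blast
    have neN: "carrier N \<noteq> {}" using N(2) by blast

    have "models N \<phi>" unfolding models_def
    proof (intro allI impI)
      fix t :: "nat \<Rightarrow> nat" assume t: "range t \<subseteq> carrier N"
      have "\<exists>q\<in>B i. ex_univ_sat N (L i) t' q"
        if i: "i \<in> I" and t': "\<forall>j<L i. t' j \<in> carrier N" for i t'
      proof -
        have "\<forall>j. \<exists>k. j < L i \<longrightarrow> t' j = v k" using t' N(2) by auto
        then obtain k where k: "\<And>j. j < L i \<Longrightarrow> t' j = v (k j)" by metis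
        define \<sigma> where "\<sigma> = map k [0..<L i]"
        have "ZE (i, \<sigma>) \<in> \<Z>" unfolding \<Z>_def \<sigma>_def using i by auto
        from bspec[OF meets this] obtain \<tau> A where \<tau>: "(\<sigma> @ \<tau>, A) \<in> T" "(length \<tau>, A) \<in> B i"
          unfolding ZE_def by auto
        \<comment> \<open>The constants \<open>\<tau>\<close> that the generic set supplies for this
          instance name its witnesses in \<open>N\<close>.\<close>
        define t'' where "t'' j = (if L i \<le> j \<and> j < L i + length \<tau> then v (\<tau> ! (j - L i)) else t' j)" for j
        have "univ_sat N (length (\<sigma> @ \<tau>)) (\<lambda>j. v ((\<sigma> @ \<tau>) ! j)) A \<longleftrightarrow> univ_sat N (length (\<sigma> @ \<tau>)) t'' A"
          by (rule univ_sat_cong) (auto simp: t''_def \<sigma>_def nth_append k)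
        with pieces[OF \<tau>(1)] have "univ_sat N (L i + length \<tau>) t'' A" by (simp add: \<sigma>_def)
        then have "ex_univ_sat N (L i) t' (length \<tau>, A)"
          unfolding ex_univ_sat_def by (intro exI[of _ t'']) (auto simp: t''_def N(2))
        with \<tau>(2) show ?thesis by blast
      qed
      with sat_\<phi> neN show "sat N \<phi> t" by simp
    qed
    with scott(2)[OF N(1)] have "struct_iso M N" by simp
    then obtain h where h: "siso h M N" unfolding struct_iso_def siso_def by blast
    then have "h (s i) \<in> range v" for i
      unfolding N(2)[symmetric] by (auto simp: siso_def iso_def bij_betw_def UNIV)
    then have "\<forall>i. \<exists>k. h (s i) = v k" by blast
    then obtain k where k: "\<And>i. h (s i) = v (k i)" by metis
    \<comment> \<open>\<open>\<sigma>\<close> names the image of \<open>s\<close> in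
      \<open>N\<close>. That image has the type of \<open>s\<close> and spans \<open>N\<close>,
      which excludes both kinds of spoiling piece.\<close>
    define \<sigma> where "\<sigma> = map k [0..<r]"
    have "ZO \<sigma> \<in> \<Z>" unfolding \<Z>_def \<sigma>_def by auto
    from bspec[OF meets this] consider (type) a where "a \<in> atomic_type M r s" "(\<sigma>, {QNot a}) \<in> T"
      | (span) y where "(\<sigma> @ [y], ?out) \<in> T" unfolding ZO_def by blast
    then show False
    proof cases
      case type
      have vars: "qf_vars a \<subseteq> {..<r}" using type(1) by (auto simp: atomic_type_def split: if_splits)
      have "qf_sat N (\<lambda>i. v (\<sigma> ! i)) (QNot a)"
        using pieces[OF type(2)] univ_sat_closed[OF neN, of "{QNot a}" r] vars by (simp add: \<sigma>_def)
      moreover have "qf_sat N (\<lambda>i. v (\<sigma> ! i)) a \<longleftrightarrow> qf_sat N (\<lambda>i. h (s i)) a"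
        by (rule qf_sat_cong) (use vars in \<open>auto simp: \<sigma>_def k\<close>)
      moreover have "qf_sat N (\<lambda>i. h (s i)) a \<longleftrightarrow> qf_sat M s a"
        by (rule siso_qf_sat[OF h M(1)]) (simp add: UNIV)
      moreover have "qf_sat M s a" using type(1) by (auto simp: atomic_type_def)
      ultimately show False by simp
    next
      case span
      let ?v = "\<lambda>i. v ((\<sigma> @ [y]) ! i)"
      have vars: "tm_vars (word r n) \<subseteq> {..<r}" for n using range_word[of r] by blast
      have "univ_sat N (Suc r) ?v ?out \<longleftrightarrow> (\<forall>a\<in>?out. qf_sat N ?v a)"
        by (rule univ_sat_closed[OF neN]) (use vars in fastforce)
      moreover have "univ_sat N (Suc r) ?v ?out" using pieces[OF span] by (simp add: \<sigma>_def)
      ultimately have out: "qf_sat N ?v (QNot (Eq (Var r) (word r n)))" for n by blast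
      have "spans N r (\<lambda>i. h (s i))" by (rule siso_spans[OF h M(1) _ spans]) (simp add: UNIV)
      then obtain t where "tm_vars t \<subseteq> {..<r}" "v y = tm_val N (\<lambda>i. h (s i)) t"
        unfolding spans_def N(2) by blast
      moreover from this(1) obtain n where "t = word r n" using range_word[of r] by blast
      moreover have "tm_val N ?v (word r n) = tm_val N (\<lambda>i. h (s i)) (word r n)"
        by (rule tm_val_cong) (use vars[of n] in \<open>auto simp: \<sigma>_def k nth_append\<close>)
      moreover have "?v r = v y" by (simp add: \<sigma>_def nth_append)
      ultimately show False using out[of n] by simp
    qed
  qed
  then show ?thesis unfolding good_def conjugate_def by (elim exE conjE) (intro exI conjI)
qed

text \<open>Take a realization with \<open>s\<close> at \<open>\<sigma>\<close> and write each
  constant as a word \<open>w k\<close> in \<open>s\<close>. The orbit is defined by saying of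
  \<open>y\<close> that the words \<open>w k\<close> evaluated at \<open>y\<close> realize
  \<open>P\<close> and return \<open>y\<close> at \<open>\<sigma>\<close>. Automorphisms preserve
  this, and any realization of \<open>P\<close> has a copy of \<open>s\<close> at
  \<open>\<sigma>\<close>.\<close>

lemma supported_imp_orbit:
  fixes M :: "'a gp_struct"
  assumes M: "is_structure M" and UNIV: "carrier M = UNIV" and spans: "spans M r s"
    and P: "finite P" "\<forall>q\<in>P. ce_qf (snd q)" and \<sigma>: "length \<sigma> = r" and "\<exists>c. realizes M c P"
    and supp: "\<forall>c. realizes M c P \<longrightarrow> (\<exists>h. siso h M M \<and> (\<forall>i<r. h (s i) = c (\<sigma> ! i)))"
  shows "\<exists>A. ce_qf A \<and> (\<forall>s'. univ_sat M r s' A \<longleftrightarrow> (\<exists>h. siso h M M \<and> (\<forall>i<r. s' i = h (s i))))"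
proof -
  have ne: "carrier M \<noteq> {}" by (simp add: UNIV)
  obtain c where c: "realizes M c P" using assms(7) ..
  with supp obtain h where h: "siso h M M" "\<And>i. i < r \<Longrightarrow> h (s i) = c (\<sigma> ! i)" by blast
  \<comment> \<open>The given realization puts only a copy of \<open>s\<close> at
    \<open>\<sigma>\<close>; the inverse automorphism moves it to \<open>s\<close>.\<close>
  define g where "g = inv_into (carrier M) h"
  have g: "siso g M M" unfolding g_def by (rule siso_inv_into[OF h(1) M])
  have gh: "g (h x) = x" for x
    using h(1) by (simp add: g_def UNIV siso_def iso_def bij_betw_def)
  define c0 where "c0 k = g (c k)" for k
  have c0: "realizes M c0 P" unfolding realizes_def
  proof clarify
    fix \<tau> A assume "(\<tau>, A) \<in> P"
    with c have "univ_sat M (length \<tau>) (\<lambda>i. c (\<tau> ! i)) A" unfolding realizes_def by blast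
    with siso_univ_sat[OF g M] show "univ_sat M (length \<tau>) (\<lambda>i. c0 (\<tau> ! i)) A"
      by (simp add: UNIV c0_def)
  qed
  have c0_\<sigma>: "c0 (\<sigma> ! i) = s i" if "i < r" for i
    using h(2)[OF that] gh[of "s i"] by (simp add: c0_def)
  have "\<forall>k. \<exists>t. tm_vars t \<subseteq> {..<r} \<and> c0 k = tm_val M s t"
    using spans by (simp add: spans_def UNIV)
  from choice[OF this] obtain w where w: "\<And>k. tm_vars (w k) \<subseteq> {..<r}" "\<And>k. c0 k = tm_val M s (w k)"
    by blast
  \<comment> \<open>The parameters become words in the first \<open>r\<close> variables, and the
    bound variables, formerly from \<open>length \<tau>\<close> on, are renumbered from
    \<open>r\<close> on. Only finitely many words occur, so this is computable for any choice of
    \<open>w\<close>.\<close>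
  define \<theta> where "\<theta> \<tau> n = (if n < length \<tau> then w (\<tau> ! n) else Var (n - length \<tau> + r))"
    for \<tau> :: "nat list" and n
  have comp_\<theta>: "computable (\<lambda>n. tm_code (\<theta> \<tau> n))" for \<tau>
  proof -
    have "computable (\<lambda>n. if n < length \<tau> then tm_code (w (\<tau> ! n)) else tm_code (Var (n - length \<tau> + r)))"
      by (rule comp_finite_modification) (unfold tm_code.simps, intro comp_intros)
    then show ?thesis by (simp only: \<theta>_def if_distrib[of tm_code])
  qed
  have sat_\<theta>: "univ_sat M r y (qf_subst (\<theta> \<tau>) ` A) \<longleftrightarrow>
      univ_sat M (length \<tau>) (\<lambda>i. tm_val M y (w (\<tau> ! i))) A" for y \<tau> A
  proof
    assume l: "univ_sat M r y (qf_subst (\<theta> \<tau>) ` A)"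
    show "univ_sat M (length \<tau>) (\<lambda>i. tm_val M y (w (\<tau> ! i))) A" unfolding univ_sat_def
    proof (intro allI impI ballI)
      fix t a assume t: "extends M (length \<tau>) (\<lambda>i. tm_val M y (w (\<tau> ! i))) t" and "a \<in> A"
      \<comment> \<open>This undoes the renumbering of the bound variables.\<close>
      define y' where "y' i = (if i < r then y i else t (i - r + length \<tau>))" for i
      have "extends M r y y'" by (simp add: extends_def y'_def UNIV)
      with l \<open>a \<in> A\<close> have "qf_sat M y' (qf_subst (\<theta> \<tau>) a)" unfolding univ_sat_def by blast
      moreover have "tm_val M y' (\<theta> \<tau> n) = t n" for n
      proof (cases "n < length \<tau>")
        case True
        have "tm_val M y' (w (\<tau> ! n)) = tm_val M y (w (\<tau> ! n))"
          by (rule tm_val_cong) (use w(1)[of "\<tau> ! n"] in \<open>auto simp: y'_def\<close>)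
        with True t show ?thesis by (simp add: \<theta>_def extends_def)
      next
        case False
        then obtain m where "n = length \<tau> + m" using le_Suc_ex not_less by blast
        then show ?thesis by (simp add: \<theta>_def y'_def add.commute)
      qed
      ultimately show "qf_sat M t a" by (simp add: qf_sat_subst)
    qed
  next
    assume r: "univ_sat M (length \<tau>) (\<lambda>i. tm_val M y (w (\<tau> ! i))) A"
    show "univ_sat M r y (qf_subst (\<theta> \<tau>) ` A)" unfolding univ_sat_def
    proof (intro allI impI ballI)
      fix y' b assume y': "extends M r y y'" and "b \<in> qf_subst (\<theta> \<tau>) ` A"
      then obtain a where a: "a \<in> A" "b = qf_subst (\<theta> \<tau>) a" by blast
      have "tm_val M y' (w k) = tm_val M y (w k)" for k
        by (rule tm_val_cong) (use w(1)[of k] y' in \<open>auto simp: extends_def\<close>)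
      then have "extends M (length \<tau>) (\<lambda>i. tm_val M y (w (\<tau> ! i))) (\<lambda>n. tm_val M y' (\<theta> \<tau> n))"
        by (simp add: extends_def \<theta>_def UNIV)
      with r a show "qf_sat M y' b" unfolding univ_sat_def by (simp add: qf_sat_subst)
    qed
  qed
  \<comment> \<open>These equations identify the tuple read off at \<open>\<sigma>\<close> with
    \<open>y\<close>; otherwise only that tuple would be known to be a copy of
    \<open>s\<close>.\<close>
  have sat_w: "univ_sat M r y {Eq (Var i) (w (\<sigma> ! i))} \<longleftrightarrow> y i = tm_val M y (w (\<sigma> ! i))"
    if "i < r" for i y
    using univ_sat_closed[OF ne, of "{Eq (Var i) (w (\<sigma> ! i))}" r y] w(1)[of "\<sigma> ! i"] that by simp
  obtain ps where ps: "set ps = P" using P(1) finite_list by blast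
  let ?As = "map (\<lambda>q. qf_subst (\<theta> (fst q)) ` snd q) ps @ map (\<lambda>i. {Eq (Var i) (w (\<sigma> ! i))}) [0..<r]"
  have "ce_qf A" if "A \<in> set ?As" for A
    using that P(2) by (auto simp: ps ce_qf_subst[OF _ comp_\<theta>] ce_qf_singleton)
  from ce_qf_conj_list[OF this, where 'a = 'a] obtain A where "ce_qf A"
    and A: "\<forall>(M::'a gp_struct) r s. univ_sat M r s A \<longleftrightarrow> (\<forall>A\<in>set ?As. univ_sat M r s A)" by blast
  have sat_A: "univ_sat M r y A \<longleftrightarrow>
      realizes M (\<lambda>k. tm_val M y (w k)) P \<and> (\<forall>i<r. y i = tm_val M y (w (\<sigma> ! i)))" for y
  proof -
    have "univ_sat M r y A \<longleftrightarrow> (\<forall>q\<in>P. univ_sat M r y (qf_subst (\<theta> (fst q)) ` snd q)) \<and>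
        (\<forall>i<r. univ_sat M r y {Eq (Var i) (w (\<sigma> ! i))})"
      by (simp add: A[rule_format] ps ball_Un) auto
    then show ?thesis by (simp add: sat_\<theta> sat_w realizes_def split_beta)
  qed
  have "univ_sat M r s' A \<longleftrightarrow> (\<exists>h. siso h M M \<and> (\<forall>i<r. s' i = h (s i)))" for s'
  proof
    assume s': "univ_sat M r s' A"
    with supp obtain h where h: "siso h M M" "\<forall>i<r. h (s i) = tm_val M s' (w (\<sigma> ! i))"
      unfolding sat_A by blast
    have "\<forall>i<r. s' i = tm_val M s' (w (\<sigma> ! i))" using s' sat_A by blast
    with h show "\<exists>h. siso h M M \<and> (\<forall>i<r. s' i = h (s i))" by auto
  next
    assume "\<exists>h. siso h M M \<and> (\<forall>i<r. s' i = h (s i))"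
    then obtain h where h: "siso h M M" "\<And>i. i < r \<Longrightarrow> s' i = h (s i)" by blast
    have "univ_sat M r s A" unfolding sat_A using c0 c0_\<sigma> by (simp add: w(2)[symmetric])
    then have "univ_sat M r (\<lambda>i. h (s i)) A"
      by (intro siso_univ_sat[OF h(1) M]) (simp_all add: UNIV)
    then show "univ_sat M r s' A" using univ_sat_cong[of r s' "\<lambda>i. h (s i)" M A] h(2) by simp
  qed
  with \<open>ce_qf A\<close> show ?thesis by blast
qed

section \<open>The case of groups\<close>

lemma is_structure_struct_of_group:
  assumes "group G" shows "is_structure (struct_of_group G)"
proof -
  interpret group G by fact
  show ?thesis by (simp add: is_structure_def struct_of_group_def)
qed

text \<open>A full carrier makes the extensionality demanded by \<open>Bij\<close> vacuous, and
  homomorphisms of groups preserve identity and inverses.\<close>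

lemma auto_iff_siso:
  assumes "group G" "carrier G = UNIV"
  shows "h \<in> auto G \<longleftrightarrow> siso h (struct_of_group G) (struct_of_group G)"
proof -
  interpret group G by fact
  let ?M = "struct_of_group G"
  have bij: "h \<in> Bij (carrier G) \<longleftrightarrow> bij_betw h (carrier G) (carrier G)"
    using assms(2) by (simp add: Bij_def extensional_def)
  have iso: "h \<in> iso ?M ?M \<longleftrightarrow> h \<in> hom G G \<and> bij_betw h (carrier G) (carrier G)"
    by (simp add: iso_def hom_def struct_of_group_def)
  show ?thesis
  proof
    assume "h \<in> auto G"
    then have h: "h \<in> hom G G" "h \<in> Bij (carrier G)" by (simp_all add: auto_def)
    then interpret group_hom G G h by (intro group_hom.intro group_hom_axioms.intro group_axioms)
    show "siso h ?M ?M"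
      using h hom_one hom_inv unfolding siso_def iso bij by (simp add: struct_of_group_def)
  next
    assume "siso h ?M ?M"
    then show "h \<in> auto G" unfolding siso_def iso auto_def by (simp add: bij)
  qed
qed

lemma generating_tuple_imp_spans:
  assumes "generating_tuple G xs"
  shows "spans (struct_of_group G) (length xs) (\<lambda>i. xs ! i)"
  unfolding spans_def
proof
  let ?M = "struct_of_group G" and ?s = "\<lambda>i. xs ! i"
  fix x assume "x \<in> carrier ?M"
  then have "x \<in> generate G (set xs)" using assms by (simp add: generating_tuple_def struct_of_group_def)
  then show "\<exists>t. tm_vars t \<subseteq> {..<length xs} \<and> x = tm_val ?M ?s t"
  proof (induction rule: generate.induct)
    case one
    show ?case by (rule exI[of _ One]) (simp add: struct_of_group_def)
  next
    case (incl h)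
    then obtain i where "i < length xs" "h = xs ! i" by (metis in_set_conv_nth)
    then show ?case by (intro exI[of _ "Var i"]) simp
  next
    case (inv h)
    then obtain i where "i < length xs" "h = xs ! i" by (metis in_set_conv_nth)
    then show ?case by (intro exI[of _ "Inv (Var i)"]) (simp add: struct_of_group_def)
  next
    case (eng g h)
    then obtain t u where "tm_vars t \<subseteq> {..<length xs} \<and> g = tm_val ?M ?s t"
      "tm_vars u \<subseteq> {..<length xs} \<and> h = tm_val ?M ?s u" by blast
    then show ?case by (intro exI[of _ "Mul t u"]) (simp add: struct_of_group_def)
  qed
qed

text \<open>Lists give way to assignments, of which only the first \<open>length xs\<close> values
  matter, and \<open>\<Pi>\<^sub>1\<close> formulas to c.e. sets of matrices.\<close>

lemma orbit_computable_Pi1_iff: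
  fixes G :: "'a monoid" and xs :: "'a list"
  assumes "group G" "carrier G = UNIV"
  shows "orbit_computable_Pi1 G xs \<longleftrightarrow> (\<exists>A. ce_qf A \<and> (\<forall>s'.
    univ_sat (struct_of_group G) (length xs) s' A \<longleftrightarrow>
    (\<exists>h. siso h (struct_of_group G) (struct_of_group G) \<and> (\<forall>i<length xs. s' i = h (xs ! i)))))"
proof -
  let ?M = "struct_of_group G" and ?r = "length xs"
  let ?defines = "\<lambda>A. \<forall>s'. univ_sat ?M ?r s' A \<longleftrightarrow> (\<exists>h. siso h ?M ?M \<and> (\<forall>i<?r. s' i = h (xs ! i)))"
  have UNIV: "carrier ?M = UNIV" by (simp add: struct_of_group_def assms(2))
  then have ne: "carrier ?M \<noteq> {}" by simp
  have orbit: "ys \<in> aut_orbit G xs \<longleftrightarrow>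
      length ys = ?r \<and> (\<exists>h. siso h ?M ?M \<and> (\<forall>i<?r. ys ! i = h (xs ! i)))" for ys
    unfolding aut_orbit_def auto_iff_siso[OF assms] by (auto simp: list_eq_iff_nth_eq)
  have *: "defined_rel ?M ?r \<phi> = aut_orbit G xs \<longleftrightarrow> ?defines A"
    if sat: "\<forall>(M::'a gp_struct) s. carrier M \<noteq> {} \<longrightarrow> (sat M \<phi> s \<longleftrightarrow> univ_sat M ?r s A)" for \<phi> A
  proof -
    have "defined_rel ?M ?r \<phi> = {ys. length ys = ?r \<and> univ_sat ?M ?r (\<lambda>i. ys ! i) A}"
      using sat ne by (auto simp: defined_rel_def UNIV)
    then have "defined_rel ?M ?r \<phi> = aut_orbit G xs \<longleftrightarrow> (\<forall>ys. length ys = ?r \<longrightarrow>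
        (univ_sat ?M ?r (\<lambda>i. ys ! i) A \<longleftrightarrow> (\<exists>h. siso h ?M ?M \<and> (\<forall>i<?r. ys ! i = h (xs ! i)))))"
      unfolding set_eq_iff orbit by auto
    also have "\<dots> \<longleftrightarrow> ?defines A"
    proof
      assume l: "\<forall>ys. length ys = ?r \<longrightarrow> (univ_sat ?M ?r (\<lambda>i. ys ! i) A \<longleftrightarrow>
        (\<exists>h. siso h ?M ?M \<and> (\<forall>i<?r. ys ! i = h (xs ! i))))"
      show "?defines A"
      proof
        fix s'
        have "univ_sat ?M ?r (\<lambda>i. map s' [0..<?r] ! i) A \<longleftrightarrow> univ_sat ?M ?r s' A"
          by (rule univ_sat_cong) simp
        then show "univ_sat ?M ?r s' A \<longleftrightarrow> (\<exists>h. siso h ?M ?M \<and> (\<forall>i<?r. s' i = h (xs ! i)))"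
          using l[rule_format, of "map s' [0..<?r]"] by simp
      qed
    qed simp
    finally show ?thesis .
  qed
  show ?thesis
  proof
    assume "orbit_computable_Pi1 G xs"
    then obtain \<phi> e where \<phi>: "Pi_index 1 ?r e \<phi>" "defined_rel ?M ?r \<phi> = aut_orbit G xs"
      unfolding orbit_computable_Pi1_def computable_Pi_def by blast
    from \<phi>(1) obtain A where "ce_qf A"
      "\<forall>(M::'a gp_struct) s. carrier M \<noteq> {} \<longrightarrow> (sat M \<phi> s \<longleftrightarrow> univ_sat M ?r s A)"
      by (rule Pi_index_le_1_imp_ce_qf[OF _ order_refl])
    with *[OF this(2)] \<phi>(2) show "\<exists>A. ce_qf A \<and> ?defines A" by blast
  next
    assume "\<exists>A. ce_qf A \<and> ?defines A"
    then obtain A where A: "ce_qf A" "?defines A" by blast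
    from A(1) obtain \<phi> where "computable_Pi 1 ?r \<phi>"
      "\<forall>(M::'a gp_struct) s. carrier M \<noteq> {} \<longrightarrow> (sat M \<phi> s \<longleftrightarrow> univ_sat M ?r s A)"
      by (rule computable_Pi1_exists)
    with *[OF this(2)] A(2) show "orbit_computable_Pi1 G xs"
      unfolding orbit_computable_Pi1_def by blast
  qed
qed

theorem theorem4p5:
  fixes G :: "nat monoid"
  assumes "group G"
    and "carrier G = UNIV"
    and "computable_structure (struct_of_group G)"
    and "finitely_generated G"
  shows
    "((\<exists>\<phi>. computable_Pi 3 0 \<phi> \<and> scott_sentence (struct_of_group G) \<phi>) \<longleftrightarrow>
      (\<exists>\<phi>. computable_d_Sigma 2 0 \<phi> \<and> scott_sentence (struct_of_group G) \<phi>)) \<and>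
     ((\<exists>\<phi>. computable_d_Sigma 2 0 \<phi> \<and> scott_sentence (struct_of_group G) \<phi>) \<longleftrightarrow>
      (\<exists>xs. generating_tuple G xs \<and> orbit_computable_Pi1 G xs)) \<and>
     ((\<exists>xs. generating_tuple G xs \<and> orbit_computable_Pi1 G xs) \<longleftrightarrow>
      (\<forall>xs. generating_tuple G xs \<longrightarrow> orbit_computable_Pi1 G xs))"
    (is "(?S1 \<longleftrightarrow> ?S2) \<and> (?S2 \<longleftrightarrow> ?S3) \<and> (?S3 \<longleftrightarrow> ?S4)")
proof -
  let ?M = "struct_of_group G"
  note M = is_structure_struct_of_group[OF assms(1)] assms(3)
  have UNIV: "carrier ?M = UNIV" by (simp add: struct_of_group_def assms(2))
  \<comment> \<open>The implications form a cycle. The passage from one generating tuple to all of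
    them goes through the Scott sentence, which mentions no tuple.\<close>
  have "?S2" if "?S3"
  proof -
    from that obtain xs where xs: "generating_tuple G xs" "orbit_computable_Pi1 G xs" by blast
    from xs(2) obtain A where A: "ce_qf A" "\<forall>s'. univ_sat ?M (length xs) s' A \<longleftrightarrow>
        (\<exists>h. siso h ?M ?M \<and> (\<forall>i<length xs. s' i = h (xs ! i)))"
      unfolding orbit_computable_Pi1_iff[OF assms(1,2)] by blast
    from orbit_imp_d_Sigma2[OF M generating_tuple_imp_spans[OF xs(1)] A(1)] A(2)
    show ?thesis by blast
  qed
  moreover have "?S1" if "?S2"
    using that d_Sigma2_imp_Pi3 by blast
  moreover have "?S4" if "?S1"
  proof (intro allI impI)
    fix xs assume xs: "generating_tuple G xs"
    note spans = generating_tuple_imp_spans[OF xs]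
    from that obtain \<phi> where "computable_Pi 3 0 \<phi>" "scott_sentence ?M \<phi>" by blast
    from Pi3_imp_supported[OF M spans this]
    obtain P \<sigma> where "finite P" "\<forall>q\<in>P. ce_qf (snd q)" "length \<sigma> = length xs" "\<exists>c. realizes ?M c P"
      "\<forall>c. realizes ?M c P \<longrightarrow> (\<exists>h. siso h ?M ?M \<and> (\<forall>i<length xs. h (xs ! i) = c (\<sigma> ! i)))" by blast
    from supported_imp_orbit[OF M(1) UNIV spans this]
    show "orbit_computable_Pi1 G xs" unfolding orbit_computable_Pi1_iff[OF assms(1,2)] .
  qed
  moreover have "?S3" if "?S4"
  proof -
    \<comment> \<open>Finite generation provides a tuple to which the universal statement
      applies.\<close>
    obtain S where "finite S" "S \<subseteq> carrier G" "generate G S = carrier G"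
      using assms(4) unfolding finitely_generated_def by blast
    moreover from this(1) obtain xs where "set xs = S" using finite_list by blast
    ultimately have "generating_tuple G xs" by (simp add: generating_tuple_def)
    with that show ?thesis by blast
  qed
  ultimately show ?thesis by argo
qed

end
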